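(* Let $n\geq k\geq 4$ be integers. Then \[ S_k(n)=\begin{cases} 40 & \text{if } n=k=4,\\ 2^{t_{k-1}(n)} & \text{if } n\geq 5 \text{ or } k\geq 5.\end{cases} \] Furthermore, $K_4$ is the only $4$-vertex graph $G$ with $S_4(G)=S_4(4)$, and if $n\geq 5$ or $k\geq 5$, then the Tur\'an graph $T_{k-1}(n)$ is the only $n$-vertex graph $G$ (up to isomorphism) with $S_k(G)=S_k(n)$.
   Context: All graphs are finite and simple. An orientation of a graph $G$ assigns a direction to every edge. A tournament is an orientation of a complete graph; it is strongly connected if for any two vertices there is a directed path from each to the other. For a graph $G$ and integer $k$, $S_k(G)$ denotes the number of orientations of $G$ in which no set of $k$ vertices inducing a complete graph $K_k$ in $G$ induces a strongly connected tournament (i.e., the orientation contains no copy of any strongly connected tournament on $k$ vertices). $S_k(n)=\max\{S_k(G): G \text{ a graph with } n \text{ vertices}\}$. The Tur\'an graph $T_{k-1}(n)$ is the complete $(k-1)$-partite graph on $n$ vertices whose part sizes differ by at most one, and $t_{k-1}(n)$ is its number of edges. *)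

theory Defs
  imports "Graph_Theory.Graph_Theory"
begin

text \<open>
  A finite simple graph is a \<open>pair_graph\<close>: a finite loop-free symmetric digraph whose arcs
  are pairs of vertices, so that an edge \<open>uv\<close> appears as both \<open>(u,v)\<close> and \<open>(v,u)\<close>.
\<close>

definition edges_of :: "'a pair_pre_digraph \<Rightarrow> 'a set set" where
  "edges_of G = {{u, v} | u v. (u, v) \<in> parcs G}"

definition orientation :: "'a pair_pre_digraph \<Rightarrow> 'a pair_pre_digraph \<Rightarrow> bool" where
  "orientation D G \<longleftrightarrow>
     pverts D = pverts G \<and> parcs D \<subseteq> parcs G \<and>
     (\<forall>(u, v) \<in> parcs G. (u, v) \<in> parcs D \<longleftrightarrow> (v, u) \<notin> parcs D)"

text \<open>
  For an orientation \<open>D\<close> of \<open>G\<close> and a vertex set \<open>W\<close> inducing a complete graph in \<open>G\<close>,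
  the digraph \<open>D \<restriction> W\<close> is a tournament, so only its strong connectedness has to be tested.
\<close>

definition strong_tournament_free ::
    "nat \<Rightarrow> 'a pair_pre_digraph \<Rightarrow> 'a pair_pre_digraph \<Rightarrow> bool" where
  "strong_tournament_free k G D \<longleftrightarrow>
     \<not> (\<exists>W. W \<subseteq> pverts G \<and> card W = k \<and>
            complete_digraph k (with_proj G \<restriction> W) \<and>
            strongly_connected (with_proj D \<restriction> W))"

definition S_graph :: "nat \<Rightarrow> 'a pair_pre_digraph \<Rightarrow> nat" where
  "S_graph k G = card {D. orientation D G \<and> strong_tournament_free k G D}"

text \<open>
  Every finite graph is isomorphic to one with vertices in \<open>nat\<close>, so the maximum is
  taken over these; the set is finite and nonempty by \<open>S_max_attained\<close> below.
\<close>

definition S_max :: "nat \<Rightarrow> nat \<Rightarrow> nat" where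
  "S_max k n = Max {S_graph k G | G :: nat pair_pre_digraph.
                      pair_graph G \<and> card (pverts G) = n}"

text \<open>The \<open>r\<close> parts are the residue classes modulo \<open>r\<close> in \<open>{..<n}\<close>.\<close>

definition turan_graph :: "nat \<Rightarrow> nat \<Rightarrow> nat pair_pre_digraph" where
  "turan_graph r n =
     \<lparr>pverts = {..<n}, parcs = {(u, v). u < n \<and> v < n \<and> u mod r \<noteq> v mod r}\<rparr>"

definition turan_number :: "nat \<Rightarrow> nat \<Rightarrow> nat" where
  "turan_number r n = card (edges_of (turan_graph r n))"

lemma turan_graph_parts_balanced:
  fixes r n i j :: nat
  assumes "i < r" "j < r"
  shows "card {v. v < n \<and> v mod r = i} \<le> card {v. v < n \<and> v mod r = j} + 1"
proof -
  let ?A = "{v. v < n \<and> v mod r = i}" and ?B = "{v. v < n \<and> v mod r = j}"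
  define f where "f v = (v div r - 1) * r + j" for v
  have "?A - {i} \<subseteq> {v. v < n \<and> v mod r = i \<and> v div r \<ge> 1}"
  proof
    fix v assume v: "v \<in> ?A - {i}"
    then have "v div r \<noteq> 0" using assms by (auto simp: div_eq_0_iff)
    then show "v \<in> {v. v < n \<and> v mod r = i \<and> v div r \<ge> 1}" using v by auto
  qed
  moreover have "inj_on f {v. v < n \<and> v mod r = i \<and> v div r \<ge> 1}"
  proof (rule inj_onI)
    fix x y
    assume x: "x \<in> {v. v < n \<and> v mod r = i \<and> v div r \<ge> 1}"
      and y: "y \<in> {v. v < n \<and> v mod r = i \<and> v div r \<ge> 1}" and e: "f x = f y"
    from e have "x div r - 1 = y div r - 1" using assms by (auto simp: f_def)
    then have "x div r = y div r" using x y by auto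
    then show "x = y" using x y by (metis (mono_tags, lifting) div_mult_mod_eq mem_Collect_eq)
  qed
  moreover have "f ` {v. v < n \<and> v mod r = i \<and> v div r \<ge> 1} \<subseteq> ?B"
  proof (rule image_subsetI)
    fix v assume v: "v \<in> {v. v < n \<and> v mod r = i \<and> v div r \<ge> 1}"
    then obtain q where q: "v div r = Suc q" by (cases "v div r") auto
    then have "v = Suc q * r + i" using v by (metis (mono_tags, lifting) div_mult_mod_eq mem_Collect_eq)
    then show "f v \<in> ?B" using v assms q by (auto simp: f_def)
  qed
  ultimately have "card (?A - {i}) \<le> card ?B"
    by (intro card_inj_on_le[of f]) (auto intro: inj_on_subset)
  then show ?thesis
    by (cases "i \<in> ?A") (simp_all add: card_Diff_singleton)
qed

lemma pair_graph_turan_graph: "pair_graph (turan_graph r n)"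
proof -
  have "finite {(u, v). u < n \<and> v < n \<and> u mod r \<noteq> v mod r}"
    by (rule finite_subset[of _ "{..<n} \<times> {..<n}"]) auto
  then show ?thesis
    by unfold_locales (auto simp: turan_graph_def symmetric_def intro: symI)
qed

lemma S_graph_le:
  assumes "pair_graph G"
  shows "S_graph k G \<le> 2 ^ (card (pverts G) * card (pverts G))"
proof -
  interpret pair_graph G by fact
  let ?P = "Pow (pverts G \<times> pverts G)"
  have fin: "finite ?P" using pair_finite_verts by simp
  have "{D. orientation D G \<and> strong_tournament_free k G D}
        \<subseteq> (\<lambda>A. \<lparr>pverts = pverts G, parcs = A\<rparr>) ` ?P"
  proof
    fix D assume "D \<in> {D. orientation D G \<and> strong_tournament_free k G D}"
    then have "pverts D = pverts G" "parcs D \<subseteq> parcs G" by (auto simp: orientation_def)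
    then have "D = \<lparr>pverts = pverts G, parcs = parcs D\<rparr>" "parcs D \<in> ?P"
      using in_arcsD1 in_arcsD2 by auto
    then show "D \<in> (\<lambda>A. \<lparr>pverts = pverts G, parcs = A\<rparr>) ` ?P" by blast
  qed
  then have "S_graph k G \<le> card ?P"
    unfolding S_graph_def by (rule surj_card_le[OF fin])
  then show ?thesis
    using pair_finite_verts by (simp add: card_Pow card_cartesian_product)
qed

lemma S_max_attained:
  fixes k n :: nat
  defines "X \<equiv> {S_graph k G | G :: nat pair_pre_digraph. pair_graph G \<and> card (pverts G) = n}"
  shows "finite X" and "X \<noteq> {}"
proof -
  have "X \<subseteq> {..2 ^ (n * n)}" using S_graph_le by (auto simp: X_def)
  then show "finite X" by (rule finite_subset) simp
  have "card (pverts (turan_graph 1 n)) = n" by (simp add: turan_graph_def)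
  then show "X \<noteq> {}" using pair_graph_turan_graph by (auto simp: X_def)
qed

end

theory Submission
  imports Defs
begin

text \<open>
  Let \<open>W\<close> be a maximum clique, \<open>w = card W \<ge> k\<close>, and count orientations by their restriction to
  \<open>W\<close>, to the remaining graph, and to the edges between a vertex \<open>v \<notin> W\<close> and \<open>W\<close>. A strong
  tournament contains strong subtournaments of all sizes from \<open>3\<close> up to its own, so along a
  Hamiltonian path of the neighbours of \<open>v\<close> in \<open>W\<close> an out-neighbour of \<open>v\<close> can precede an
  in-neighbour only by fewer than \<open>k - 2\<close> steps. Hence \<open>d\<close> edges from \<open>v\<close> to \<open>W\<close> can be oriented in
  at most \<open>2 ^ (k - 3) * (d + 4 - k)\<close> ways, which for \<open>w > k\<close> is at most the number of choices
  available in the Turan graph, and for \<open>w = k\<close> exceeds it by a factor that is compensated by the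
  remaining Turan edges and by the scarcity of tournaments on \<open>k\<close> vertices that are not strong.
  The compensation is tight for \<open>k = 4\<close>, where \<open>K\<^sub>4\<close> itself beats the Turan graph
  (\<open>40 > 2 ^ 5\<close>) and seven vertices need a finer count. Graphs without a \<open>k\<close>-clique are covered
  by Turan's theorem.
\<close>

section \<open>Strong subtournaments and one-vertex extensions\<close>

text \<open>The induction is on the number of vertices, with the rest \<open>V - W\<close> bounded
  by \<open>free_bound\<close>. The Turan graph on \<open>w + m\<close> vertices consists of Turan
  graphs on \<open>w\<close> and on \<open>m\<close> vertices and the edges between them, so the
  three factors of the count are compared one at a time. Maximality of \<open>W\<close> leaves each
  outside vertex at most \<open>w - 1\<close> neighbours in \<open>W\<close>. For
  \<open>w > k\<close> the bound
  \<open>ext_bound k (w - 1) \<le> 2 ^ (w - 1 - (w - 1) div (k - 1))\<close> suffices. For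
  \<open>w = k\<close> it fails, as \<open>3 * 2 ^ (k - 3) > 2 ^ (k - 2)\<close>. There the exact
  number of edges between the blocks helps: it is \<open>k - 1\<close> per outside vertex, less one
  for every \<open>k - 1\<close> of them. Each vertex thus gains a factor \<open>3 / 4\<close>,
  against a loss of \<open>2\<close> per \<open>k - 1 \<ge> 3\<close> vertices, and
  \<open>27 * 2 < 64\<close>. For \<open>k = 4\<close> the surplus \<open>40 / 32 = 5 / 4\<close> is
  absorbed as well unless \<open>m = 0\<close> or \<open>m = 3\<close>, where
  \<open>5 * 54 > 4 * 64\<close>; this is the seven-vertex case. Uniqueness comes from strictness:
  apart from \<open>K\<^sub>4\<close> with \<open>k = 4\<close>, a graph with a
  \<open>k\<close>-clique stays strictly below the bound, so an extremal graph has none, all its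
  orientations count, and the equality case of Turan's theorem applies.\<close>

text \<open>Only pairs of distinct vertices of \<open>W\<close> are constrained, so the same
  \<open>R\<close> can be tested on every vertex subset.\<close>

definition tournament_on :: "'a set \<Rightarrow> 'a rel \<Rightarrow> bool" where
  "tournament_on W R \<longleftrightarrow> (\<forall>u\<in>W. \<forall>v\<in>W. u \<noteq> v \<longrightarrow> ((u, v) \<in> R \<longleftrightarrow> (v, u) \<notin> R))"

text \<open>Strong connectedness phrased through cuts: no proper nonempty subset is closed under
  out-arcs. The link to directed paths is \<open>strongly_connected_pair_iff\<close>.\<close>

definition strong_on :: "'a rel \<Rightarrow> 'a set \<Rightarrow> bool" where
  "strong_on R W \<longleftrightarrow> (\<forall>A\<subseteq>W. A \<noteq> {} \<longrightarrow> R \<inter> A \<times> (W - A) = {} \<longrightarrow> A = W)"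

lemma strong_onD:
  "strong_on R W \<Longrightarrow> A \<subseteq> W \<Longrightarrow> A \<noteq> {} \<Longrightarrow> (\<And>a b. a \<in> A \<Longrightarrow> b \<in> W - A \<Longrightarrow> (a, b) \<notin> R) \<Longrightarrow> A = W"
  unfolding strong_on_def by blast

lemma strong_onI:
  "(\<And>A. A \<subseteq> W \<Longrightarrow> A \<noteq> {} \<Longrightarrow> (\<And>a b. a \<in> A \<Longrightarrow> b \<in> W \<Longrightarrow> (a, b) \<in> R \<Longrightarrow> b \<in> A) \<Longrightarrow> W \<subseteq> A)
   \<Longrightarrow> strong_on R W"
  unfolding strong_on_def by blast

lemma strong_on_cong:
  assumes "\<And>u v. u \<in> W \<Longrightarrow> v \<in> W \<Longrightarrow> (u, v) \<in> R \<longleftrightarrow> (u, v) \<in> R'"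
  shows "strong_on R W \<longleftrightarrow> strong_on R' W"
proof -
  have "R \<inter> A \<times> (W - A) = R' \<inter> A \<times> (W - A)" if "A \<subseteq> W" for A
    using assms that by blast
  then show ?thesis unfolding strong_on_def by auto
qed

lemma strong_on_singleton [simp]: "strong_on R {x}"
  unfolding strong_on_def by blast

lemma tournament_on_subset: "tournament_on W R \<Longrightarrow> U \<subseteq> W \<Longrightarrow> tournament_on U R"
  unfolding tournament_on_def by blast

text \<open>
  If no outside vertex extends \<open>S\<close>, then each one dominates \<open>S\<close> or is dominated by it; an arc
  from a dominated vertex \<open>b\<close> to a dominating vertex \<open>a\<close> makes \<open>S' \<union> {a, b}\<close> strong for
  every nonempty \<open>S' \<subseteq> S\<close>.
\<close>

lemma strong_on_grow:
  assumes tour: "tournament_on W R" and strong: "strong_on R W"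
    and S: "S \<subseteq> W" "S \<noteq> {}" "S \<noteq> W" "strong_on R S" "finite S"
  shows "\<exists>S'\<subseteq>W. strong_on R S' \<and> card S' = (if card S = 1 then 3 else card S + 1)"
proof (cases "\<exists>u\<in>W - S. \<exists>p\<in>S. \<exists>q\<in>S. (u, p) \<in> R \<and> (q, u) \<in> R")
  case True
  then obtain u p q where u: "u \<in> W" "u \<notin> S" "p \<in> S" "q \<in> S" "(u, p) \<in> R" "(q, u) \<in> R"
    by blast
  \<comment> \<open>A single vertex would be joined to \<open>u\<close> in both directions. From
    size 1 only the other case remains, which jumps to a 3-cycle, since no tournament on two
    vertices is strong.\<close>
  have "card S \<noteq> 1"
  proof
    assume "card S = 1"
    then obtain s where "S = {s}" by (rule card_1_singletonE)
    then have "p = q" "p \<in> W" "p \<noteq> u" using u S(1) by auto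
    then show False using u(1,5,6) tour unfolding tournament_on_def by blast
  qed
  moreover have "strong_on R (insert u S)"
  proof (rule strong_onI)
    fix A assume A: "A \<subseteq> insert u S" "A \<noteq> {}"
      and cl: "\<And>a b. a \<in> A \<Longrightarrow> b \<in> insert u S \<Longrightarrow> (a, b) \<in> R \<Longrightarrow> b \<in> A"
    have "A \<inter> S \<noteq> {}" using A cl u by blast
    then have "A \<inter> S = S" using cl by (intro strong_onD[OF S(4)]) auto
    then show "insert u S \<subseteq> A" using cl[of q u] u by blast
  qed
  ultimately show ?thesis using u S by (intro exI[of _ "insert u S"]) auto
next
  case False
  define A where "A = {u \<in> W - S. \<forall>p\<in>S. (u, p) \<in> R \<and> (p, u) \<notin> R}"
  define B where "B = {u \<in> W - S. \<forall>p\<in>S. (p, u) \<in> R \<and> (u, p) \<notin> R}"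
  have dir: "(u, p) \<in> R \<longleftrightarrow> (p, u) \<notin> R" if "u \<in> W - S" "p \<in> S" for u p
  proof -
    have "u \<in> W" "p \<in> W" "u \<noteq> p" using that S(1) by auto
    then show ?thesis using tour unfolding tournament_on_def by blast
  qed
  have AB: "u \<in> A \<or> u \<in> B" if "u \<in> W - S" for u
  proof (cases "\<exists>p\<in>S. (u, p) \<in> R")
    case True
    then have "\<forall>q\<in>S. (q, u) \<notin> R" using False that by blast
    then show ?thesis using dir[OF that] that unfolding A_def by blast
  next
    case False
    then show ?thesis using dir[OF that] that unfolding B_def by blast
  qed
  have sub: "A \<subseteq> W - S" "B \<subseteq> W - S" by (auto simp: A_def B_def)
  have noAR: "(p, a) \<notin> R" if "a \<in> A" "p \<in> S" for a p using that by (auto simp: A_def)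
  have noBR: "(b, p) \<notin> R" if "b \<in> B" "p \<in> S" for b p using that by (auto simp: B_def)
  \<comment> \<open>Otherwise first \<open>S \<union> B\<close> and then \<open>B\<close> is closed
    under out-arcs, so both equal \<open>W\<close>, although \<open>S\<close> is nonempty and
    disjoint from \<open>B\<close>.\<close>
  have "\<exists>a\<in>A. \<exists>b\<in>B. (b, a) \<in> R"
  proof (rule ccontr)
    assume none: "\<not> ?thesis"
    have "S \<union> B = W"
    proof (rule strong_onD[OF strong])
      fix x y assume "x \<in> S \<union> B" "y \<in> W - (S \<union> B)"
      then show "(x, y) \<notin> R" using AB[of y] none noAR by blast
    qed (use S sub in auto)
    then have "B \<noteq> {}" using S by blast
    then have "B = W"
      using \<open>S \<union> B = W\<close> noBR sub by (intro strong_onD[OF strong]) auto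
    then show False using S sub by blast
  qed
  then obtain a b where ab: "a \<in> A" "b \<in> B" "(b, a) \<in> R" by blast
  have str: "strong_on R (insert a (insert b S'))" if S': "S' \<subseteq> S" "S' \<noteq> {}" for S'
  proof (rule strong_onI)
    fix C assume C: "C \<subseteq> insert a (insert b S')" "C \<noteq> {}"
      and cl: "\<And>x y. x \<in> C \<Longrightarrow> y \<in> insert a (insert b S') \<Longrightarrow> (x, y) \<in> R \<Longrightarrow> y \<in> C"
    have "a \<in> C \<Longrightarrow> S' \<subseteq> C" using cl ab S' by (auto simp: A_def)
    moreover have "b \<in> C \<Longrightarrow> a \<in> C" using cl ab by auto
    moreover have "p \<in> S' \<Longrightarrow> p \<in> C \<Longrightarrow> b \<in> C" for p using cl ab S' by (auto simp: B_def)
    ultimately show "insert a (insert b S') \<subseteq> C" using C S' by blast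
  qed
  have nin: "a \<in> W" "b \<in> W" "a \<notin> S" "b \<notin> S" "a \<noteq> b"
    using ab S(2) by (auto simp: A_def B_def)
  show ?thesis
  proof (cases "card S = 1")
    case True
    then show ?thesis using str[of S] S nin by (intro exI[of _ "insert a (insert b S)"]) auto
  next
    case False
    \<comment> \<open>Adding \<open>a\<close> and \<open>b\<close> gives one vertex too many;
      dropping one vertex of \<open>S\<close> corrects the size.\<close>
    obtain x where x: "x \<in> S" using S by blast
    have "S - {x} \<noteq> {}"
    proof
      assume "S - {x} = {}"
      then have "S = {x}" using x by blast
      then show False using False by simp
    qed
    moreover have "card S > 0" using S x by (auto simp: card_gt_0_iff)
    ultimately show ?thesis using str[of "S - {x}"] S nin False x
      by (intro exI[of _ "insert a (insert b (S - {x}))"]) auto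
  qed
qed

text \<open>Repeated growth from a single vertex: the first step reaches size 3, every later one
  adds a vertex.\<close>

lemma strong_subtournament_of_size:
  assumes tour: "tournament_on W R" and strong: "strong_on R W" and "finite W"
    and "3 \<le> k" "k \<le> card W"
  shows "\<exists>U\<subseteq>W. card U = k \<and> strong_on R U"
  using assms(4,5)
proof (induction k rule: dec_induct)
  case base
  then obtain x where x: "x \<in> W" by fastforce
  then have "{x} \<noteq> W" using base by auto
  then show ?case using strong_on_grow[OF tour strong, of "{x}"] x by auto
next
  case (step k)
  then obtain U where U: "U \<subseteq> W" "card U = k" "strong_on R U" by auto
  then have "U \<noteq> {}" "U \<noteq> W" "card U \<noteq> 1" "finite U"
    using step \<open>finite W\<close> finite_subset by auto
  then show ?case using strong_on_grow[OF tour strong U(1) _ _ U(3)] U by auto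
qed

section \<open>Orientations and forbidden strong cliques as relations\<close>

definition clique_in :: "'a rel \<Rightarrow> 'a set \<Rightarrow> bool" where
  "clique_in E W \<longleftrightarrow> (\<forall>u\<in>W. \<forall>v\<in>W. u \<noteq> v \<longrightarrow> (u, v) \<in> E)"

definition orients :: "'a rel \<Rightarrow> 'a rel set" where
  "orients E = {R. R \<subseteq> E \<and> (\<forall>u v. (u, v) \<in> E \<longrightarrow> ((u, v) \<in> R \<longleftrightarrow> (v, u) \<notin> R))}"

text \<open>By \<open>S_graph_eq\<close> this is the set counted by \<open>S_graph\<close>. Keeping
  only the arcs makes restriction to a vertex subset a plain intersection.\<close>

definition free_orients :: "nat \<Rightarrow> 'a rel \<Rightarrow> 'a rel set" where
  "free_orients k E =
     {R \<in> orients E. \<forall>W. card W = k \<longrightarrow> clique_in E W \<longrightarrow> \<not> strong_on R W}"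

lemma clique_in_subset: "clique_in E W \<Longrightarrow> U \<subseteq> W \<Longrightarrow> clique_in E U"
  unfolding clique_in_def by blast

lemma tournament_on_orients: "R \<in> orients E \<Longrightarrow> clique_in E W \<Longrightarrow> tournament_on W R"
  unfolding orients_def clique_in_def tournament_on_def by blast

lemma free_orients_no_large_strong:
  assumes "R \<in> free_orients k E" "clique_in E W" "finite W" "3 \<le> k" "k \<le> card W"
  shows "\<not> strong_on R W"
proof
  assume "strong_on R W"
  moreover have "tournament_on W R"
    using assms by (intro tournament_on_orients[of R E]) (auto simp: free_orients_def)
  ultimately obtain U where U: "U \<subseteq> W" "card U = k" "strong_on R U"
    using strong_subtournament_of_size[of W R k] assms by blast
  then have "clique_in E U" using assms(2) clique_in_subset by blast
  then show False using assms(1) U by (auto simp: free_orients_def)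
qed

text \<open>Redei's theorem: the new vertex is inserted just before the first path vertex that it
  dominates.\<close>

lemma tournament_hamiltonian_path:
  assumes "finite W" "tournament_on W R"
  shows "\<exists>xs. distinct xs \<and> set xs = W \<and> successively (\<lambda>x y. (x, y) \<in> R) xs"
  using assms
proof (induction W)
  case empty
  then show ?case by auto
next
  case (insert v W)
  then obtain xs where xs: "distinct xs" "set xs = W" "successively (\<lambda>x y. (x, y) \<in> R) xs"
    using tournament_on_subset[of "insert v W" R W] by auto
  define ys where "ys = takeWhile (\<lambda>x. (x, v) \<in> R) xs"
  define zs where "zs = dropWhile (\<lambda>x. (x, v) \<in> R) xs"
  have split: "xs = ys @ zs" by (simp add: ys_def zs_def)
  have "ys \<noteq> [] \<Longrightarrow> (last ys, v) \<in> R"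
    using set_takeWhileD[of "last ys" "\<lambda>x. (x, v) \<in> R" xs] by (auto simp: ys_def)
  moreover have "(v, hd zs) \<in> R" if "zs \<noteq> []"
  proof -
    have "(hd zs, v) \<notin> R" using that hd_dropWhile[of "\<lambda>x. (x, v) \<in> R" xs] by (auto simp: zs_def)
    moreover have "hd zs \<in> W" using that xs split by auto
    ultimately show ?thesis
      using insert.prems insert.hyps(2) unfolding tournament_on_def by (metis insert_iff)
  qed
  ultimately have "successively (\<lambda>x y. (x, y) \<in> R) (ys @ v # zs)"
    using xs(3) unfolding split by (cases zs) (auto simp: successively_append_iff successively_Cons)
  moreover have "distinct (ys @ v # zs)" "set (ys @ v # zs) = insert v W"
    using xs insert split by auto
  ultimately show ?case by blast
qed

text \<open>
  \<open>X\<close> is the set of out-neighbours of a new vertex; entering a path \<open>xs\<close> at position \<open>i\<close> and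
  leaving it at position \<open>j > i\<close> closes a cycle on \<open>j - i + 2\<close> vertices.
\<close>

definition few_returns :: "nat \<Rightarrow> 'a list \<Rightarrow> 'a set \<Rightarrow> bool" where
  "few_returns k xs X \<longleftrightarrow>
     (\<forall>i j. i < j \<longrightarrow> j < length xs \<longrightarrow> xs ! i \<in> X \<longrightarrow> xs ! j \<notin> X \<longrightarrow> j - i + 2 < k)"

text \<open>Up to \<open>d = k - 2\<close> a path of \<open>d\<close> vertices closes no cycle on
  \<open>k\<close> vertices, so all \<open>2 ^ d\<close> sets are possible. From there on each
  further vertex adds only \<open>2 ^ (k - 3)\<close>; the two formulas agree at
  \<open>d = k - 2\<close>.\<close>

definition ext_bound :: "nat \<Rightarrow> nat \<Rightarrow> nat" where
  "ext_bound k d = (if d + 2 \<le> k then 2 ^ d else 2 ^ (k - 3) * (d + 4 - k))"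

text \<open>Induction along the path. If the first vertex \<open>x\<close> is not in
  \<open>X\<close>, the tail is counted; if it is, every vertex of \<open>xs\<close> after the first
  \<open>k - 3\<close> must be in \<open>X\<close>, which leaves \<open>2 ^ (k - 3)\<close>
  choices.\<close>

lemma card_few_returns:
  assumes "3 \<le> k" "distinct xs"
  shows "card {X. X \<subseteq> set xs \<and> few_returns k xs X} \<le> ext_bound k (length xs)"
  using assms(2)
proof (induction xs)
  case Nil
  have "{X. X \<subseteq> set [] \<and> few_returns k [] X} \<subseteq> {{}}" by auto
  from card_mono[OF _ this] show ?case using assms by (simp add: ext_bound_def)
next
  case (Cons x xs)
  show ?case
  proof (cases "length (x # xs) + 2 \<le> k")
    case True
    have "card {X. X \<subseteq> set (x # xs) \<and> few_returns k (x # xs) X} \<le> card (Pow (set (x # xs)))"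
      by (intro card_mono) auto
    also have "\<dots> = 2 ^ length (x # xs)"
      using Cons(2) by (subst card_Pow) (auto simp: distinct_card)
    finally show ?thesis using True by (simp add: ext_bound_def)
  next
    case False
    define Y where "Y = set (take (k - 3) xs)"
    let ?all = "{X. X \<subseteq> set (x # xs) \<and> few_returns k (x # xs) X}"
    let ?in = "{X \<in> ?all. x \<in> X}" and ?out = "{X \<in> ?all. x \<notin> X}"
    have fin: "finite ?all" by (rule finite_subset[of _ "Pow (set (x # xs))"]) auto
    have "?out \<subseteq> {X. X \<subseteq> set xs \<and> few_returns k xs X}"
    proof
      fix X assume X: "X \<in> ?out"
      have "j - i + 2 < k" if "i < j" "j < length xs" "xs ! i \<in> X" "xs ! j \<notin> X" for i j
      proof -
        have "few_returns k (x # xs) X" using X by simp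
        from this[unfolded few_returns_def, rule_format, of "Suc i" "Suc j"] that
        show ?thesis by simp
      qed
      then show "X \<in> {X. X \<subseteq> set xs \<and> few_returns k xs X}"
        using X by (auto simp: few_returns_def)
    qed
    then have out: "card ?out \<le> ext_bound k (length xs)"
      by (intro order_trans[OF card_mono Cons.IH])
        (use Cons(2) in \<open>auto intro: finite_subset[of _ "Pow (set xs)"]\<close>)
    have late: "y \<in> X" if "X \<in> ?in" "y \<in> set xs" "y \<notin> Y" for X y
    proof (rule ccontr)
      assume "y \<notin> X"
      obtain j where j: "j < length xs" "y = xs ! j" using \<open>y \<in> set xs\<close> by (metis in_set_conv_nth)
      have "j \<ge> k - 3"
      proof (rule ccontr)
        assume "\<not> ?thesis"
        then have "j < length (take (k - 3) xs)" "y = take (k - 3) xs ! j" using j by auto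
        then have "y \<in> Y" unfolding Y_def by (metis nth_mem)
        then show False using that by blast
      qed
      have "few_returns k (x # xs) X" using that by simp
      from this[unfolded few_returns_def, rule_format, of 0 "Suc j"]
      show False using that j \<open>y \<notin> X\<close> \<open>j \<ge> k - 3\<close> by simp
    qed
    have "inj_on (\<lambda>X. X \<inter> Y) ?in"
    proof (rule inj_onI)
      fix X1 X2 assume X: "X1 \<in> ?in" "X2 \<in> ?in" "X1 \<inter> Y = X2 \<inter> Y"
      have "z \<in> X1 \<longleftrightarrow> z \<in> X2" for z
      proof (cases "z \<in> set xs \<and> z \<notin> Y")
        case True
        then show ?thesis using late[of X1 z] late[of X2 z] X by blast
      next
        case False
        then show ?thesis using X by auto
      qed
      then show "X1 = X2" by blast
    qed
    then have "card ?in \<le> card (Pow Y)"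
      by (intro card_inj_on_le[of "\<lambda>X. X \<inter> Y"]) (auto simp: Y_def)
    also have "card Y \<le> k - 3" unfolding Y_def using card_length[of "take (k - 3) xs"] by simp
    then have "card (Pow Y) \<le> 2 ^ (k - 3)" by (subst card_Pow) (auto simp: Y_def)
    finally have inn: "card ?in \<le> 2 ^ (k - 3)" .
    have "card ?all = card ?in + card ?out"
    proof -
      have "?all = ?in \<union> ?out" by blast
      then have "card ?all = card (?in \<union> ?out)" by (rule arg_cong)
      also have "\<dots> = card ?in + card ?out"
        using fin by (intro card_Un_disjoint) (auto intro: finite_subset[OF _ fin])
      finally show ?thesis .
    qed
    also have "\<dots> \<le> 2 ^ (k - 3) + ext_bound k (length xs)" using inn out by simp
    also have "\<dots> = ext_bound k (length (x # xs))"
    \<comment> \<open>Here the exponential regime meets the linear one: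
      \<open>2 ^ (k - 3) + 2 ^ (k - 2) = 3 * 2 ^ (k - 3)\<close>.\<close>
    proof (cases "length xs + 2 = k")
      case True
      then have "length xs = Suc (k - 3)" using assms by simp
      then show ?thesis using True assms by (simp add: ext_bound_def)
    next
      case c: False
      then have "length xs + 2 > k" using False by simp
      then have "length (x # xs) + 4 - k = Suc (length xs + 4 - k)" by simp
      then show ?thesis using c False by (simp add: ext_bound_def)
    qed
    finally show ?thesis .
  qed
qed

section \<open>Attaching one vertex to an oriented clique\<close>

definition joined :: "'a rel \<Rightarrow> 'a \<Rightarrow> 'a set \<Rightarrow> 'a set \<Rightarrow> 'a rel" where
  "joined R v N X = R \<union> {v} \<times> X \<union> (N - X) \<times> {v}"

text \<open>\<open>X\<close> collects the neighbours in \<open>N\<close> that receive an arc from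
  \<open>v\<close>; the others send one to \<open>v\<close>. Only \<open>k\<close>-sets consisting
  of \<open>v\<close> and vertices of \<open>N\<close> are tested; dropping \<open>k\<close>-sets
  with several vertices outside the clique keeps the count an upper bound and makes the choices for
  different \<open>v\<close> independent.\<close>

definition extensions :: "nat \<Rightarrow> 'a rel \<Rightarrow> 'a rel \<Rightarrow> 'a \<Rightarrow> 'a set \<Rightarrow> 'a set set" where
  "extensions k E R v N = {X. X \<subseteq> N \<and>
     (\<forall>U\<subseteq>N. clique_in E U \<longrightarrow> card U = k - 1 \<longrightarrow> \<not> strong_on (joined R v N X) (insert v U))}"

lemma extensionsD:
  "X \<in> extensions k E R v N \<Longrightarrow> U \<subseteq> N \<Longrightarrow> clique_in E U \<Longrightarrow> card U = k - 1 \<Longrightarrow>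
    \<not> strong_on (joined R v N X) (insert v U)"
  by (auto simp: extensions_def)

lemma finite_extensions: "finite N \<Longrightarrow> finite (extensions k E R v N)"
  by (rule finite_subset[of _ "Pow N"]) (auto simp: extensions_def)

lemma closed_successively:
  assumes "successively (\<lambda>x y. (x, y) \<in> R) zs" "zs \<noteq> []" "hd zs \<in> A"
    and "\<And>a b. a \<in> A \<Longrightarrow> b \<in> set zs \<Longrightarrow> (a, b) \<in> R \<Longrightarrow> b \<in> A"
  shows "set zs \<subseteq> A"
  using assms
proof (induction zs)
  case (Cons z zs)
  show ?case
  proof (cases "zs = []")
    case True
    then show ?thesis using Cons.prems by simp
  next
    case False
    then have "(z, hd zs) \<in> R" "successively (\<lambda>x y. (x, y) \<in> R) zs"
      using Cons.prems(1) by (auto simp: successively_Cons)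
    moreover have "hd zs \<in> A" using calculation(1) Cons.prems(3,4) False by auto
    ultimately have "set zs \<subseteq> A" using Cons.IH False Cons.prems(4) by auto
    then show ?thesis using Cons.prems(3) by simp
  qed
qed simp

text \<open>A closed set is carried forward along the path to its last vertex, from there to
  \<open>v\<close>, and then around the whole cycle.\<close>

lemma strong_on_cycle:
  assumes path: "successively (\<lambda>x y. (x, y) \<in> R) zs" "zs \<noteq> []"
    and "(v, hd zs) \<in> R" "(last zs, v) \<in> R"
  shows "strong_on R (insert v (set zs))"
proof (rule strong_onI)
  fix A assume A: "A \<subseteq> insert v (set zs)" "A \<noteq> {}"
    and cl: "\<And>a b. a \<in> A \<Longrightarrow> b \<in> insert v (set zs) \<Longrightarrow> (a, b) \<in> R \<Longrightarrow> b \<in> A"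
  have "v \<in> A"
  proof (cases "A \<inter> set zs = {}")
    case True
    then show ?thesis using A by blast
  next
    case False
    then obtain z where z: "z \<in> A" "z \<in> set zs" by blast
    then obtain as' bs' where split: "zs = as' @ z # bs'" by (auto dest: split_list)
    have "set (z # bs') \<subseteq> A"
      using path z cl by (intro closed_successively[of R]) (auto simp: split successively_append_iff)
    then have "last zs \<in> A" unfolding split by auto
    then show ?thesis using cl assms(4) by auto
  qed
  then have "hd zs \<in> A" using cl assms(2,3) by auto
  then have "set zs \<subseteq> A" using path cl by (intro closed_successively[of R]) auto
  then show "insert v (set zs) \<subseteq> A" using \<open>v \<in> A\<close> by simp
qed

lemma joined_iff:
  assumes "R \<subseteq> W \<times> W" "v \<notin> W" "N \<subseteq> W" "X \<subseteq> N"
  shows "a \<in> N \<Longrightarrow> b \<in> N \<Longrightarrow> (a, b) \<in> joined R v N X \<longleftrightarrow> (a, b) \<in> R"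
    and "a \<in> N \<Longrightarrow> (v, a) \<in> joined R v N X \<longleftrightarrow> a \<in> X"
    and "a \<in> N \<Longrightarrow> (a, v) \<in> joined R v N X \<longleftrightarrow> a \<notin> X"
    and "(v, v) \<notin> joined R v N X"
  using assms unfolding joined_def by auto

text \<open>A return over \<open>k - 2\<close> or more steps closes a cycle on at least
  \<open>k\<close> vertices. Its vertex set carries a strong tournament, which contains a strong
  \<open>k\<close>-set: one through \<open>v\<close> contradicts \<open>extensions\<close>, one
  avoiding \<open>v\<close> contradicts that \<open>R\<close> is free.\<close>

lemma card_extensions_le:
  assumes R: "R \<in> free_orients k (E \<inter> W \<times> W)" and v: "v \<notin> W"
    and N: "N \<subseteq> W" "finite N" "clique_in E N" and k: "3 \<le> k"
  shows "card (extensions k E R v N) \<le> ext_bound k (card N)"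
proof -
  have RW: "R \<subseteq> W \<times> W" and ori: "R \<in> orients (E \<inter> W \<times> W)"
    using R by (auto simp: free_orients_def orients_def)
  have cl: "clique_in (E \<inter> W \<times> W) N" using N unfolding clique_in_def by blast
  have tour: "tournament_on N R" by (rule tournament_on_orients[OF ori cl])
  obtain xs where xs: "distinct xs" "set xs = N" "successively (\<lambda>x y. (x, y) \<in> R) xs"
    using tournament_hamiltonian_path[OF N(2) tour] by blast
  have "few_returns k xs X" if X: "X \<in> extensions k E R v N" for X
    unfolding few_returns_def
  proof (intro allI impI)
    fix i j assume ij: "i < j" "j < length xs" "xs ! i \<in> X" "xs ! j \<notin> X"
    let ?J = "joined R v N X"
    have XN: "X \<subseteq> N" using X by (auto simp: extensions_def)
    note J = joined_iff[OF RW v N(1) XN]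
    \<comment> \<open>The path segment from \<open>xs ! i\<close> to \<open>xs ! j\<close>, both
      ends included; with \<open>v\<close> it has \<open>j - i + 2\<close> vertices.\<close>
    define zs where "zs = take (Suc j - i) (drop i xs)"
    have len: "length zs = Suc j - i" using ij by (simp add: zs_def)
    have zs: "zs \<noteq> []" "hd zs = xs ! i" "last zs = xs ! j"
      using ij len by (auto simp: zs_def hd_drop_conv_nth last_conv_nth)
    have sub: "set zs \<subseteq> N" unfolding zs_def xs(2)[symmetric]
      by (meson set_drop_subset set_take_subset order_trans)
    have vz: "v \<notin> set zs" using sub N v by blast
    have "distinct zs" using xs(1) by (simp add: zs_def)
    then have cardz: "card (insert v (set zs)) = j - i + 2"
      using vz ij len by (simp add: distinct_card)
    have "successively (\<lambda>x y. (x, y) \<in> R) zs"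
    proof -
      have "xs = take i xs @ zs @ drop (Suc j - i) (drop i xs)"
        unfolding zs_def by (metis append_take_drop_id)
      then show ?thesis using xs(3) by (metis successively_append_iff)
    qed
    then have "successively (\<lambda>x y. (x, y) \<in> ?J) zs"
      by (rule successively_mono) (auto simp: joined_def)
    moreover have "xs ! i \<in> N" "xs ! j \<in> N" using ij xs by auto
    ultimately have strong: "strong_on ?J (insert v (set zs))"
      using zs ij J by (intro strong_on_cycle) auto
    have tourJ: "tournament_on (insert v (set zs)) ?J"
    proof -
      have "((a, b) \<in> ?J) = ((b, a) \<notin> ?J)"
        if ab: "a \<in> insert v (set zs)" "b \<in> insert v (set zs)" "a \<noteq> b" for a b
      proof (cases "a = v \<or> b = v")
        case True
        then show ?thesis using ab J(2,3) sub by blast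
      next
        case False
        then have "a \<in> N" "b \<in> N" using ab sub by auto
        then have "(a, b) \<in> R \<longleftrightarrow> (b, a) \<notin> R"
          using tour ab(3) unfolding tournament_on_def by blast
        then show ?thesis using J(1)[of a b] J(1)[of b a] \<open>a \<in> N\<close> \<open>b \<in> N\<close> by blast
      qed
      then show ?thesis unfolding tournament_on_def by blast
    qed
    show "j - i + 2 < k"
    proof (rule ccontr)
      assume "\<not> ?thesis"
      then obtain U where U: "U \<subseteq> insert v (set zs)" "card U = k" "strong_on ?J U"
        using strong_subtournament_of_size[OF tourJ strong, of k] k cardz by auto
      show False
      proof (cases "v \<in> U")
        case True
        then have "insert v (U - {v}) = U" "U - {v} \<subseteq> N" "card (U - {v}) = k - 1"
          using U sub by auto
        moreover have "clique_in E (U - {v})" using calculation(2) N(3) clique_in_subset by blast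
        ultimately show False using extensionsD[OF X, of "U - {v}"] U(3) by simp
      next
        case False
        then have UN: "U \<subseteq> N" using U sub by auto
        have "strong_on ?J U \<longleftrightarrow> strong_on R U"
          using UN J(1) by (intro strong_on_cong) auto
        then show False
          using R U UN clique_in_subset[OF cl] unfolding free_orients_def by auto
      qed
    qed
  qed
  then have "extensions k E R v N \<subseteq> {X. X \<subseteq> set xs \<and> few_returns k xs X}"
    using xs by (auto simp: extensions_def)
  then have "card (extensions k E R v N) \<le> card {X. X \<subseteq> set xs \<and> few_returns k xs X}"
    by (intro card_mono) (auto intro: finite_subset[of _ "Pow (set xs)"])
  also have "\<dots> \<le> ext_bound k (card N)"
    using card_few_returns[OF k xs(1)] xs by (metis distinct_card)
  finally show ?thesis .
qed

text \<open>A vertex with both an in-neighbour and an out-neighbour in a strong set extends it to a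
  strong set, so all edges at \<open>v\<close> must point the same way.\<close>

lemma card_extensions_strong:
  assumes "R \<subseteq> W \<times> W" "v \<notin> W" "N \<subseteq> W" "clique_in E N" "card N = k - 1" "strong_on R N"
  shows "card (extensions k E R v N) \<le> 2"
proof -
  have "X = {} \<or> X = N" if X: "X \<in> extensions k E R v N" for X
  proof (rule ccontr)
    assume not: "\<not> ?thesis"
    have XN: "X \<subseteq> N" using X by (auto simp: extensions_def)
    note J = joined_iff[OF assms(1,2,3) XN]
    obtain x y where xy: "x \<in> X" "y \<in> N - X" using not XN by blast
    have "strong_on (joined R v N X) (insert v N)"
    proof (rule strong_onI)
      fix A assume A: "A \<subseteq> insert v N" "A \<noteq> {}"
        and cl: "\<And>a b. a \<in> A \<Longrightarrow> b \<in> insert v N \<Longrightarrow> (a, b) \<in> joined R v N X \<Longrightarrow> b \<in> A"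
      have "A \<inter> N \<noteq> {}"
      proof
        assume "A \<inter> N = {}"
        then have "v \<in> A" using A by blast
        then have "x \<in> A" using cl[of v x] J(2)[of x] xy XN by blast
        then show False using \<open>A \<inter> N = {}\<close> xy XN by blast
      qed
      then have "A \<inter> N = N" using cl J(1) by (intro strong_onD[OF assms(6)]) blast+
      then show "insert v N \<subseteq> A" using cl[of y v] J(3)[of y] xy by blast
    qed
    then show False using X assms unfolding extensions_def by blast
  qed
  then have "extensions k E R v N \<subseteq> {{}, N}" by blast
  then have "card (extensions k E R v N) \<le> card {{}, N}" by (intro card_mono) auto
  also have "\<dots> \<le> 2" by (simp add: card_insert_if)
  finally show ?thesis .
qed

section \<open>Splitting an orientation along a vertex set\<close>

lemma orients_restrict: "R \<in> orients E \<Longrightarrow> R \<inter> W \<times> W \<in> orients (E \<inter> W \<times> W)"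
  unfolding orients_def by blast

text \<open>Sets of at most one vertex are cliques of every relation, wherever they lie; from two
  vertices on, each vertex of a clique has an arc, which places it in \<open>W\<close>.\<close>

lemma clique_in_restrict:
  assumes "clique_in (E \<inter> W \<times> W) U" "2 \<le> card U"
  shows "U \<subseteq> W" "clique_in E U"
proof -
  show "U \<subseteq> W"
  proof
    fix u assume "u \<in> U"
    have "card (U - {u}) \<ge> 1" using assms(2) \<open>u \<in> U\<close> by simp
    then have "U - {u} \<noteq> {}" by force
    then show "u \<in> W" using assms(1) \<open>u \<in> U\<close> unfolding clique_in_def by blast
  qed
qed (use assms in \<open>auto simp: clique_in_def\<close>)

lemma free_orients_restrict:
  assumes "R \<in> free_orients k E" "2 \<le> k"
  shows "R \<inter> W \<times> W \<in> free_orients k (E \<inter> W \<times> W)"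
proof -
  have "\<not> strong_on (R \<inter> W \<times> W) U" if U: "card U = k" "clique_in (E \<inter> W \<times> W) U" for U
  proof -
    have "U \<subseteq> W" "clique_in E U" using clique_in_restrict[OF U(2)] U(1) assms(2) by auto
    then have "strong_on (R \<inter> W \<times> W) U \<longleftrightarrow> strong_on R U" by (intro strong_on_cong) auto
    then show ?thesis using assms(1) U(1) \<open>clique_in E U\<close> by (auto simp: free_orients_def)
  qed
  then show ?thesis using assms(1) orients_restrict unfolding free_orients_def by blast
qed

lemma out_neighbours_extension:
  assumes R: "R \<in> free_orients k E" and "sym E" "v \<notin> W" "2 \<le> k"
  shows "{u \<in> W. (v, u) \<in> R} \<in> extensions k E (R \<inter> W \<times> W) v (W \<inter> E `` {v})"
proof -
  let ?N = "W \<inter> E `` {v}" and ?X = "{u \<in> W. (v, u) \<in> R}"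
  have RE: "R \<subseteq> E" and ori: "\<And>a b. (a, b) \<in> E \<Longrightarrow> ((a, b) \<in> R \<longleftrightarrow> (b, a) \<notin> R)"
    using R by (auto simp: free_orients_def orients_def)
  have XN: "?X \<subseteq> ?N" using RE by blast
  have J: "(a, b) \<in> joined (R \<inter> W \<times> W) v ?N ?X \<longleftrightarrow> (a, b) \<in> R"
    if "a \<in> insert v ?N" "b \<in> insert v ?N" for a b
    using that ori[of v a] ori[of v b] ori[of v v] RE \<open>v \<notin> W\<close> unfolding joined_def by auto
  have "\<not> strong_on (joined (R \<inter> W \<times> W) v ?N ?X) (insert v U)"
    if U: "U \<subseteq> ?N" "clique_in E U" "card U = k - 1" for U
  proof -
    have "finite U" using U \<open>2 \<le> k\<close> by (auto intro: card_ge_0_finite)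
    then have "card (insert v U) = k" using U \<open>v \<notin> W\<close> \<open>2 \<le> k\<close> by (subst card_insert_disjoint) auto
    moreover have "clique_in E (insert v U)"
      using U \<open>sym E\<close> unfolding clique_in_def by (auto dest: symD)
    ultimately have "\<not> strong_on R (insert v U)" using R by (auto simp: free_orients_def)
    moreover have "strong_on (joined (R \<inter> W \<times> W) v ?N ?X) (insert v U) \<longleftrightarrow> strong_on R (insert v U)"
      using U J by (intro strong_on_cong) blast
    ultimately show ?thesis by simp
  qed
  then show ?thesis using XN unfolding extensions_def by blast
qed

lemma finite_orients: "finite E \<Longrightarrow> finite (orients E)"
  by (rule finite_subset[of _ "Pow E"]) (auto simp: orients_def)

lemma finite_free_orients: "finite E \<Longrightarrow> finite (free_orients k E)"
  by (rule finite_subset[OF _ finite_orients]) (auto simp: free_orients_def)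

text \<open>An orientation is determined by its trace on \<open>W\<close>, the out-neighbourhoods in
  \<open>W\<close> of the outside vertices, and its trace on \<open>V - W\<close>. The filter
  \<open>Q\<close> serves the seven-vertex case, where tournaments are sorted by whether a given
  triangle is strong.\<close>

lemma card_free_orients_restricted_le:
  assumes "finite V" "E \<subseteq> V \<times> V" "sym E" "W \<subseteq> V" "2 \<le> k"
  shows "card {R \<in> free_orients k E. Q (R \<inter> W \<times> W)} \<le>
    (\<Sum>R | R \<in> free_orients k (E \<inter> W \<times> W) \<and> Q R. \<Prod>v\<in>V - W. card (extensions k E R v (W \<inter> E `` {v})))
      * card (free_orients k (E \<inter> (V - W) \<times> (V - W)))"
proof -
  let ?Z = "V - W"
  let ?FZ = "free_orients k (E \<inter> ?Z \<times> ?Z)"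
  let ?FW = "{R \<in> free_orients k (E \<inter> W \<times> W). Q R}"
  let ?F = "{R \<in> free_orients k E. Q (R \<inter> W \<times> W)}"
  let ?X = "\<lambda>R. \<Pi>\<^sub>E v\<in>?Z. extensions k E R v (W \<inter> E `` {v})"
  let ?f = "\<lambda>R. (R \<inter> W \<times> W, (\<lambda>v\<in>?Z. {u \<in> W. (v, u) \<in> R}), R \<inter> ?Z \<times> ?Z)"
  have fin: "finite E" "finite W" using assms finite_subset by fastforce+
  have "inj_on ?f ?F"
  proof (rule inj_onI)
    fix R1 R2 assume R: "R1 \<in> ?F" "R2 \<in> ?F" "?f R1 = ?f R2"
    have out: "{u \<in> W. (v, u) \<in> R1} = {u \<in> W. (v, u) \<in> R2}" if "v \<in> ?Z" for v
      using R(3) that by (metis (no_types, lifting) Pair_inject restrict_apply')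
    have o: "R1 \<in> orients E" "R2 \<in> orients E" using R by (auto simp: free_orients_def)
    have "(a, b) \<in> R1 \<longleftrightarrow> (a, b) \<in> R2" if ab: "(a, b) \<in> E" for a b
    proof -
      have V: "a \<in> V" "b \<in> V" using ab assms by auto
      have o': "(a, b) \<in> R1 \<longleftrightarrow> (b, a) \<notin> R1" "(a, b) \<in> R2 \<longleftrightarrow> (b, a) \<notin> R2"
        using o ab unfolding orients_def by blast+
      consider "a \<in> W" "b \<in> W" | "a \<in> ?Z" "b \<in> ?Z" | "a \<in> ?Z" "b \<in> W" | "a \<in> W" "b \<in> ?Z"
        using V by blast
      then show ?thesis
      proof cases
        case 1 then show ?thesis using R(3) by blast
      next
        case 2 then show ?thesis using R(3) by blast
      next
        case 3 then show ?thesis using out[of a] by blast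
      next
        case 4 then show ?thesis using out[of b] o' by blast
      qed
    qed
    then show "R1 = R2" using o unfolding orients_def by auto
  qed
  moreover have "?f ` ?F \<subseteq> (SIGMA R:?FW. ?X R \<times> ?FZ)"
    using assms by (auto intro!: free_orients_restrict out_neighbours_extension)
  moreover have finW: "finite ?FW" using fin finite_free_orients[of "E \<inter> W \<times> W" k] by simp
  then have "finite (SIGMA R:?FW. ?X R \<times> ?FZ)"
    using assms fin by (intro finite_SigmaI finite_cartesian_product finite_free_orients finite_PiE
        finite_extensions) auto
  ultimately have "card ?F \<le> card (SIGMA R:?FW. ?X R \<times> ?FZ)"
    using card_inj_on_le by blast
  also have "\<dots> = (\<Sum>R\<in>?FW. card (?X R \<times> ?FZ))"
    using assms fin finW by (intro card_SigmaI) (auto intro!: finite_free_orients finite_PiE finite_extensions)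
  also have "\<dots> = (\<Sum>R\<in>?FW. (\<Prod>v\<in>?Z. card (extensions k E R v (W \<inter> E `` {v}))) * card ?FZ)"
    using assms by (simp add: card_cartesian_product card_PiE)
  finally show ?thesis by (simp add: sum_distrib_right)
qed

lemmas card_free_orients_le = card_free_orients_restricted_le[where Q = "\<lambda>_. True", simplified]

section \<open>Counting tournaments without large strong subtournaments\<close>

text \<open>All edges are directed upwards along an injective numbering of the vertices.\<close>

lemma orients_nonempty:
  assumes "finite E" "sym E" "irrefl E"
  shows "orients E \<noteq> {}"
proof -
  have "finite (Field E)" using assms(1) by (rule finite_Field)
  from finite_imp_inj_to_nat_seg[OF this]
  obtain f :: "'a \<Rightarrow> nat" where f: "inj_on f (Field E)" by blast
  have "(u, v) \<in> E \<Longrightarrow> f u \<noteq> f v" for u v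
    using f assms(3) unfolding irrefl_def by (metis FieldI1 FieldI2 inj_on_contraD)
  then have "{(u, v) \<in> E. f u < f v} \<in> orients E"
    using assms(2) unfolding orients_def by (fastforce dest: symD)
  then show ?thesis by blast
qed

text \<open>\<open>H\<close> selects one arc of each edge; any other orientation is determined by
  the edges on which it agrees with \<open>H\<close>, and these can be prescribed freely.\<close>

lemma orients_half:
  assumes "finite E" "sym E" "H \<in> orients E"
  shows "card E = 2 * card H" and "card (orients E) = 2 ^ card H"
proof -
  have H: "H \<subseteq> E" "\<And>u v. (u, v) \<in> E \<Longrightarrow> ((u, v) \<in> H \<longleftrightarrow> (v, u) \<notin> H)"
    using assms(3) by (auto simp: orients_def)
  have E: "E = H \<union> H\<inverse>" using H assms(2) by (auto dest: symD)
  have "H \<inter> H\<inverse> = {}" using H by auto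
  moreover have "finite H" using H assms(1) finite_subset by blast
  ultimately show "card E = 2 * card H"
    by (subst E, subst card_Un_disjoint) (auto simp: card_inverse)
  have "bij_betw (\<lambda>R. R \<inter> H) (orients E) (Pow H)"
  proof (rule bij_betwI[where g = "\<lambda>X. X \<union> (H - X)\<inverse>"])
    show "(\<lambda>X. X \<union> (H - X)\<inverse>) \<in> Pow H \<rightarrow> orients E"
    proof
      fix X assume "X \<in> Pow H"
      then show "X \<union> (H - X)\<inverse> \<in> orients E"
        using H(2) unfolding orients_def E by blast
    qed
    fix R assume "R \<in> orients E"
    then have R: "R \<subseteq> E" "\<And>u v. (u, v) \<in> E \<Longrightarrow> ((u, v) \<in> R \<longleftrightarrow> (v, u) \<notin> R)"
      by (auto simp: orients_def)
    show "R \<inter> H \<union> (H - R \<inter> H)\<inverse> = R"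
    proof (intro equalityI subrelI)
      fix a b assume "(a, b) \<in> R"
      then show "(a, b) \<in> R \<inter> H \<union> (H - R \<inter> H)\<inverse>" using R(1) R(2)[of a b] E by blast
    next
      fix a b assume "(a, b) \<in> R \<inter> H \<union> (H - R \<inter> H)\<inverse>"
      then show "(a, b) \<in> R" using R(2)[of b a] H(1) by blast
    qed
  next
    fix X assume "X \<in> Pow H"
    then show "(X \<union> (H - X)\<inverse>) \<inter> H = X" using H by blast
  qed auto
  then show "card (orients E) = 2 ^ card H"
    using \<open>finite H\<close> by (simp add: bij_betw_same_card card_Pow)
qed

lemma card_orients:
  assumes "finite E" "sym E" "irrefl E"
  shows "card (orients E) = 2 ^ (card E div 2)" and "even (card E)"
proof -
  obtain H where "H \<in> orients E" using orients_nonempty[OF assms] by blast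
  from orients_half[OF assms(1,2) this]
  show "card (orients E) = 2 ^ (card E div 2)" "even (card E)" by auto
qed

abbreviation complete_arcs :: "'a set \<Rightarrow> 'a rel" where
  "complete_arcs V \<equiv> V \<times> V - Id"

lemma complete_arcs_simple: "sym (complete_arcs V)" "irrefl (complete_arcs V)"
  by (auto simp: sym_def irrefl_def)

lemma card_complete_arcs: "finite V \<Longrightarrow> card (complete_arcs V) = card V * (card V - 1)"
proof -
  assume "finite V"
  moreover have "complete_arcs V = V \<times> V - (\<lambda>x. (x, x)) ` V" by auto
  ultimately have "card (complete_arcs V) = card (V \<times> V) - card ((\<lambda>x. (x, x)) ` V)"
    by (simp add: card_Diff_subset image_subset_iff)
  then show ?thesis by (simp add: card_image inj_on_def card_cartesian_product algebra_simps diff_mult_distrib2)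
qed

lemma clique_in_complete: "W \<subseteq> V \<Longrightarrow> clique_in (complete_arcs V) W"
  by (auto simp: clique_in_def)

lemma clique_in_complete_iff: "2 \<le> card W \<Longrightarrow> clique_in (complete_arcs V) W \<longleftrightarrow> W \<subseteq> V"
  using clique_in_restrict(1)[of "- Id" V W] clique_in_complete[of W V]
  by (auto simp: Int_commute Diff_eq)

lemma free_orients_eq_orients:
  assumes "\<And>W. clique_in E W \<Longrightarrow> card W \<noteq> k"
  shows "free_orients k E = orients E"
  using assms by (auto simp: free_orients_def)

lemma free_orients_complete_small:
  assumes "finite V" "card V < k" "2 \<le> k"
  shows "free_orients k (complete_arcs V) = orients (complete_arcs V)"
proof (rule free_orients_eq_orients)
  fix W assume "clique_in (complete_arcs V) W"
  then show "card W \<noteq> k" using assms card_mono[of V W] clique_in_complete_iff[of W V] by fastforce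
qed

lemma card_free_orients_complete_small:
  assumes "finite V" "card V < k" "2 \<le> k"
  shows "card (free_orients k (complete_arcs V)) = 2 ^ (card V * (card V - 1) div 2)"
  using assms card_orients(1)[OF _ complete_arcs_simple, of V]
  by (simp add: free_orients_complete_small card_complete_arcs)

section \<open>Terminal strong components\<close>

definition strong_tours :: "'a set \<Rightarrow> 'a rel set" where
  "strong_tours A = {R \<in> orients (complete_arcs A). strong_on R A}"

text \<open>Vertices \<open>a \<in> A - B\<close> and \<open>b \<in> B - A\<close> are joined by an
  arc, which would leave one of the two closed sets.\<close>

lemma closed_sets_nested:
  assumes "tournament_on V R" "A \<subseteq> V" "B \<subseteq> V"
    and "R \<inter> A \<times> (V - A) = {}" "R \<inter> B \<times> (V - B) = {}"
  shows "A \<subseteq> B \<or> B \<subseteq> A"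
proof (rule ccontr)
  assume "\<not> ?thesis"
  then obtain a b where "a \<in> A" "a \<notin> B" "b \<in> B" "b \<notin> A" by blast
  moreover have "a \<in> V" "b \<in> V" "a \<noteq> b" using calculation assms by auto
  ultimately show False using assms unfolding tournament_on_def by blast
qed

lemma closed_strong_unique:
  assumes "tournament_on V R" "A \<subseteq> V" "B \<subseteq> V" "A \<noteq> {}" "B \<noteq> {}"
    and "R \<inter> A \<times> (V - A) = {}" "R \<inter> B \<times> (V - B) = {}" "strong_on R A" "strong_on R B"
  shows "A = B"
  using closed_sets_nested[OF assms(1,2,3,6,7)]
proof
  assume "A \<subseteq> B"
  then show ?thesis using assms by (intro strong_onD[OF assms(9)]) auto
next
  assume "B \<subseteq> A"
  then have "B = A" using assms by (intro strong_onD[OF assms(8)]) auto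
  then show ?thesis ..
qed

text \<open>A minimal nonempty closed set is strong: a subset closed within it is closed in
  \<open>V\<close> as well.\<close>

lemma ex_closed_strong:
  assumes "finite V" "V \<noteq> {}"
  shows "\<exists>A\<subseteq>V. A \<noteq> {} \<and> R \<inter> A \<times> (V - A) = {} \<and> strong_on R A"
proof -
  define C where "C = {A. A \<subseteq> V \<and> A \<noteq> {} \<and> R \<inter> A \<times> (V - A) = {}}"
  have "finite C" by (rule finite_subset[of _ "Pow V"]) (use assms in \<open>auto simp: C_def\<close>)
  moreover have "C \<noteq> {}" using assms by (auto simp: C_def)
  ultimately obtain A where A: "A \<in> C" "\<And>B. B \<in> C \<Longrightarrow> B \<subseteq> A \<Longrightarrow> A = B"
    using finite_has_minimal[of C] by blast
  have "strong_on R A"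
  proof (rule strong_onI)
    fix B assume B: "B \<subseteq> A" "B \<noteq> {}" "\<And>a b. a \<in> B \<Longrightarrow> b \<in> A \<Longrightarrow> (a, b) \<in> R \<Longrightarrow> b \<in> B"
    then have "B \<in> C" using A(1) unfolding C_def by blast
    then show "A \<subseteq> B" using A(2)[of B] B(1) by blast
  qed
  then show ?thesis using A(1) unfolding C_def by blast
qed

text \<open>
  A tournament is determined by its terminal strong component \<open>A\<close>, the strong tournament on
  \<open>A\<close>, and the tournament on the remaining vertices; a strong set of \<open>k\<close> vertices lies in the
  rest as soon as \<open>card A < k\<close>.
\<close>

lemma bij_betw_terminal_component:
  assumes "finite V" "V \<noteq> {}" "3 \<le> k"
  shows "bij_betw (\<lambda>(A, R, S). R \<union> S \<union> (V - A) \<times> A)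
    (SIGMA A:{A. A \<subseteq> V \<and> A \<noteq> {} \<and> card A < k}.
       strong_tours A \<times> free_orients k (complete_arcs (V - A)))
    (free_orients k (complete_arcs V))" (is "bij_betw ?g ?S ?F")
proof -
  have split: "A \<subseteq> V" "A \<noteq> {}" "card A < k" "R \<subseteq> A \<times> A" "S \<subseteq> (V - A) \<times> (V - A)"
      "R \<in> orients (complete_arcs A)" "strong_on R A" "S \<in> free_orients k (complete_arcs (V - A))"
      "S \<in> orients (complete_arcs (V - A))"
    if "(A, R, S) \<in> ?S" for A R S
    using that unfolding strong_tours_def free_orients_def orients_def by auto
  have ori: "R \<union> S \<union> (V - A) \<times> A \<in> orients (complete_arcs V)" if "(A, R, S) \<in> ?S" for A R S
    using split[OF that] unfolding orients_def by blast
  have parts: "R = (R \<union> S \<union> (V - A) \<times> A) \<inter> A \<times> A"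
      "S = (R \<union> S \<union> (V - A) \<times> A) \<inter> (V - A) \<times> (V - A)" if "(A, R, S) \<in> ?S" for A R S
    using split(4,5)[OF that] by blast+
  have comp: "(R \<union> S \<union> (V - A) \<times> A) \<inter> A \<times> (V - A) = {}"
      "strong_on (R \<union> S \<union> (V - A) \<times> A) A" if "(A, R, S) \<in> ?S" for A R S
  proof -
    note sp = split[OF that]
    show "(R \<union> S \<union> (V - A) \<times> A) \<inter> A \<times> (V - A) = {}" using sp(4,5) by blast
    have "strong_on (R \<union> S \<union> (V - A) \<times> A) A \<longleftrightarrow> strong_on R A"
      using sp(4,5) by (intro strong_on_cong) blast
    then show "strong_on (R \<union> S \<union> (V - A) \<times> A) A" using sp(7) by blast
  qed
  have "inj_on ?g ?S"
  proof (rule inj_onI)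
    fix x y assume xy: "x \<in> ?S" "y \<in> ?S" "?g x = ?g y"
    obtain A R S where x: "x = (A, R, S)" by (cases x)
    obtain A' R' S' where y: "y = (A', R', S')" by (cases y)
    have 1: "(A, R, S) \<in> ?S" "(A', R', S') \<in> ?S" using xy x y by auto
    have eq: "R \<union> S \<union> (V - A) \<times> A = R' \<union> S' \<union> (V - A') \<times> A'" using xy(3) x y by simp
    have tour: "tournament_on V (R \<union> S \<union> (V - A) \<times> A)"
      using tournament_on_orients[OF ori[OF 1(1)] clique_in_complete] by simp
    have "A = A'"
      by (rule closed_strong_unique[OF tour split(1)[OF 1(1)] split(1)[OF 1(2)]
            split(2)[OF 1(1)] split(2)[OF 1(2)] comp(1)[OF 1(1)] _ comp(2)[OF 1(1)]])
        (unfold eq, (rule comp[OF 1(2)])+)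
    moreover have "R = R'"
      using parts(1)[OF 1(1)] parts(1)[OF 1(2)] unfolding eq unfolding \<open>A = A'\<close>
      by (rule trans[OF _ sym])
    moreover have "S = S'"
      using parts(2)[OF 1(1)] parts(2)[OF 1(2)] unfolding eq unfolding \<open>A = A'\<close>
      by (rule trans[OF _ sym])
    ultimately show "x = y" using x y by simp
  qed
  moreover have "?g ` ?S \<subseteq> ?F"
  proof (rule image_subsetI, clarify)
    fix A R S assume "A \<subseteq> V" "A \<noteq> {}" "card A < k" "R \<in> strong_tours A"
      "S \<in> free_orients k (complete_arcs (V - A))"
    then have mem: "(A, R, S) \<in> ?S" by simp
    note sp = split[OF mem]
    let ?Q = "R \<union> S \<union> (V - A) \<times> A"
    have "\<not> strong_on ?Q W" if W: "card W = k" "clique_in (complete_arcs V) W" for W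
    proof
      assume str: "strong_on ?Q W"
      have WV: "W \<subseteq> V" using W assms(3) clique_in_complete_iff[of W V] by simp
      show False
      proof (cases "W \<inter> A = {}")
        case True
        then have WVA: "W \<subseteq> V - A" using WV by blast
        then have "strong_on ?Q W \<longleftrightarrow> strong_on S W"
          using sp(4) by (intro strong_on_cong) blast
        then show False using sp(8) W str clique_in_complete[OF WVA] by (auto simp: free_orients_def)
      next
        case False
        \<comment> \<open>No arc leaves \<open>A\<close>, so \<open>W \<inter> A\<close> is closed
          within the strong set \<open>W\<close>; hence \<open>W\<close> lies in \<open>A\<close>,
          which is too small for \<open>k\<close> vertices.\<close>
        have "W \<inter> A = W"
          by (rule strong_onD[OF str]) (use False sp(4,5) in auto)
        then have "W \<subseteq> A" by blast
        then have "card W \<le> card A" using sp(1) assms(1) by (meson card_mono finite_subset)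
        then show False using W sp(3) by simp
      qed
    qed
    then show "?Q \<in> ?F" using ori[OF mem] unfolding free_orients_def by blast
  qed
  moreover have "?F \<subseteq> ?g ` ?S"
  proof
    fix Q assume Q: "Q \<in> ?F"
    obtain A where A: "A \<subseteq> V" "A \<noteq> {}" "Q \<inter> A \<times> (V - A) = {}" "strong_on Q A"
      using ex_closed_strong[OF assms(1,2), of Q] by blast
    have "card A < k"
    proof (rule ccontr)
      assume "\<not> ?thesis"
      then show False
        using free_orients_no_large_strong[OF Q clique_in_complete[OF A(1)] _ assms(3)] A
          finite_subset[OF A(1) assms(1)] by simp
    qed
    have Qo: "Q \<subseteq> complete_arcs V" "\<And>u v. (u, v) \<in> complete_arcs V \<Longrightarrow> (u, v) \<in> Q \<longleftrightarrow> (v, u) \<notin> Q"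
      using Q unfolding free_orients_def orients_def by auto
    have r: "complete_arcs V \<inter> U \<times> U = complete_arcs U" if "U \<subseteq> V" for U using that by blast
    have "Q \<inter> A \<times> A \<in> free_orients k (complete_arcs A)"
      using free_orients_restrict[OF Q, of A] r[OF A(1)] assms(3) by simp
    moreover have "strong_on (Q \<inter> A \<times> A) A \<longleftrightarrow> strong_on Q A" by (intro strong_on_cong) blast
    ultimately have "Q \<inter> A \<times> A \<in> strong_tours A"
      using A(4) by (simp add: strong_tours_def free_orients_def)
    moreover have "Q \<inter> (V - A) \<times> (V - A) \<in> free_orients k (complete_arcs (V - A))"
      using free_orients_restrict[OF Q, of "V - A"] r[of "V - A"] assms(3) by auto
    moreover have "Q = Q \<inter> A \<times> A \<union> Q \<inter> (V - A) \<times> (V - A) \<union> (V - A) \<times> A"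
    proof (intro equalityI subrelI)
      fix a b assume "(a, b) \<in> Q"
      then show "(a, b) \<in> Q \<inter> A \<times> A \<union> Q \<inter> (V - A) \<times> (V - A) \<union> (V - A) \<times> A"
        using Qo(1) A(3) by blast
    next
      fix a b assume "(a, b) \<in> Q \<inter> A \<times> A \<union> Q \<inter> (V - A) \<times> (V - A) \<union> (V - A) \<times> A"
      then show "(a, b) \<in> Q" using Qo(2)[of a b] A(1,3) by blast
    qed
    ultimately show "Q \<in> ?g ` ?S" using A \<open>card A < k\<close>
      by (intro image_eqI[of _ _ "(A, Q \<inter> A \<times> A, Q \<inter> (V - A) \<times> (V - A))"]) auto
  qed
  ultimately show ?thesis unfolding bij_betw_def by blast
qed

lemma sum_subsets_by_card:
  fixes g :: "nat \<Rightarrow> nat"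
  assumes "finite V" "finite J"
  shows "(\<Sum>A | A \<subseteq> V \<and> card A \<in> J. g (card A)) = (\<Sum>j\<in>J. (card V choose j) * g j)"
proof -
  have "{A. A \<subseteq> V \<and> card A \<in> J} = (\<Union>j\<in>J. {A. A \<subseteq> V \<and> card A = j})" by blast
  then have "(\<Sum>A | A \<subseteq> V \<and> card A \<in> J. g (card A)) =
      (\<Sum>j\<in>J. \<Sum>A | A \<subseteq> V \<and> card A = j. g (card A))"
    using assms(1) by (simp only:) (rule sum.UNION_disjoint[OF assms(2)], auto)
  also have "\<dots> = (\<Sum>j\<in>J. (card V choose j) * g j)"
    using assms by (intro sum.cong) (auto simp: n_subsets)
  finally show ?thesis .
qed

text \<open>The summand for \<open>j\<close> counts the tournaments whose terminal component has
  \<open>j\<close> vertices. Since this component is nonempty, \<open>f\<close> is consulted only on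
  proper subsets, so the equation is a genuine recursion.\<close>

lemma card_free_orients_complete_rec:
  assumes "finite V" "V \<noteq> {}" "3 \<le> k"
    and "\<And>A. A \<subseteq> V \<Longrightarrow> A \<noteq> {} \<Longrightarrow> card A < k \<Longrightarrow> card (strong_tours A) = s (card A)"
    and "\<And>U. U \<subset> V \<Longrightarrow> card (free_orients k (complete_arcs U)) = f (card U)"
  shows "card (free_orients k (complete_arcs V)) =
    (\<Sum>j\<in>{1..<k}. (card V choose j) * (s j * f (card V - j)))"
proof -
  let ?I = "{A. A \<subseteq> V \<and> A \<noteq> {} \<and> card A < k}"
  have fin: "finite ?I" by (rule finite_subset[of _ "Pow V"]) (use assms in auto)
  have I: "?I = {A. A \<subseteq> V \<and> card A \<in> {1..<k}}"
    using assms(1) by (auto simp: Suc_le_eq card_gt_0_iff dest: finite_subset)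
  have "finite (strong_tours A)" if "A \<subseteq> V" for A
    using that assms(1) finite_subset[OF that] 
    by (intro finite_subset[OF _ finite_orients[of "complete_arcs A"]]) (auto simp: strong_tours_def)
  then have "card (free_orients k (complete_arcs V)) =
      (\<Sum>A\<in>?I. card (strong_tours A \<times> free_orients k (complete_arcs (V - A))))"
    unfolding bij_betw_same_card[OF bij_betw_terminal_component[OF assms(1,2,3)], symmetric]
    using fin assms(1) by (intro card_SigmaI) (auto intro!: finite_free_orients)
  also have "\<dots> = (\<Sum>A\<in>?I. s (card A) * f (card V - card A))"
  proof (rule sum.cong[OF refl])
    fix A assume A: "A \<in> ?I"
    then have "V - A \<subset> V" "card (V - A) = card V - card A"
      using assms(1) by (auto simp: card_Diff_subset finite_subset)
    then show "card (strong_tours A \<times> free_orients k (complete_arcs (V - A))) =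
        s (card A) * f (card V - card A)"
      using A assms(4)[of A] assms(5)[of "V - A"] by (simp add: card_cartesian_product)
  qed
  also have "\<dots> = (\<Sum>j\<in>{1..<k}. (card V choose j) * (s j * f (card V - j)))"
    unfolding I using sum_subsets_by_card[OF assms(1), of "{1..<k}" "\<lambda>j. s j * f (card V - j)"] by simp
  finally show ?thesis .
qed

lemma card_strong_tours_rec:
  assumes "finite V" "V \<noteq> {}" "card V < k" "3 \<le> k"
    and "\<And>A. A \<subset> V \<Longrightarrow> A \<noteq> {} \<Longrightarrow> card (strong_tours A) = s (card A)"
  shows "2 ^ (card V * (card V - 1) div 2) =
    card (strong_tours V) + (\<Sum>j\<in>{1..<card V}. (card V choose j) *
       (s j * 2 ^ ((card V - j) * (card V - j - 1) div 2)))"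
proof -
  let ?n = "card V"
  define s' where "s' j = (if j = ?n then card (strong_tours V) else s j)" for j
  \<comment> \<open>Forbidding strong sets of more than \<open>card V\<close> vertices forbids
    nothing, so all tournaments are counted; adding 3 also meets the lower bound on the parameter.
    The summand for \<open>j = card V\<close> is the unknown number of strong tournaments.\<close>
  have "2 ^ (?n * (?n - 1) div 2) = card (free_orients (?n + 3) (complete_arcs V))"
    using assms by (subst card_free_orients_complete_small) auto
  also have "\<dots> = (\<Sum>j\<in>{1..<?n + 3}. (?n choose j) * (s' j * 2 ^ ((?n - j) * (?n - j - 1) div 2)))"
  proof (rule card_free_orients_complete_rec)
    fix A assume "A \<subseteq> V" "A \<noteq> {}"
    then show "card (strong_tours A) = s' (card A)"
      using assms(5)[of A] psubset_card_mono[OF assms(1), of A]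
      by (cases "A = V") (simp_all add: s'_def psubset_eq)
  next
    fix U assume "U \<subset> V"
    then show "card (free_orients (?n + 3) (complete_arcs U)) = 2 ^ (card U * (card U - 1) div 2)"
      using assms(1) psubset_card_mono[OF assms(1), of U]
      by (intro card_free_orients_complete_small) (auto intro: finite_subset)
  qed (use assms in auto)
  also have "\<dots> = (\<Sum>j\<in>{1..?n}. (?n choose j) * (s' j * 2 ^ ((?n - j) * (?n - j - 1) div 2)))"
    by (rule sum.mono_neutral_right) auto
  also have "{1..?n} = insert ?n {1..<?n}"
    using assms(1,2) by (auto simp: Suc_le_eq card_gt_0_iff)
  finally show ?thesis by (simp add: s'_def)
qed

text \<open>Numbers of labelled strong tournaments on 1 to 4 vertices: 1, 0, 2, 24. The value 0 is
  genuine at \<open>n = 2\<close> and a filler for \<open>n = 0\<close> and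
  \<open>n \<ge> 5\<close>.\<close>

definition strong_number :: "nat \<Rightarrow> nat" where
  "strong_number n = (if n = 1 then 1 else if n = 3 then 2 else if n = 4 then 24 else 0)"

lemma small_binomials:
  "4 choose 2 = (6::nat)" "4 choose 3 = (4::nat)"
  "5 choose 2 = (10::nat)" "5 choose 3 = (10::nat)" "5 choose 4 = (5::nat)"
  by (simp_all add: eval_nat_numeral)

lemma card_strong_tours:
  assumes "finite V" "V \<noteq> {}" "card V \<le> 4"
  shows "card (strong_tours V) = strong_number (card V)"
  using assms
proof (induction "card V" arbitrary: V rule: less_induct)
  case less
  have sub: "card (strong_tours A) = strong_number (card A)" if "A \<subset> V" "A \<noteq> {}" for A
    using that less psubset_card_mono[OF less.prems(1) that(1)] by (auto intro: finite_subset)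
  have rec: "2 ^ (card V * (card V - 1) div 2) =
    card (strong_tours V) + (\<Sum>j\<in>{1..<card V}. (card V choose j) *
       (strong_number j * 2 ^ ((card V - j) * (card V - j - 1) div 2)))"
    by (rule card_strong_tours_rec[of _ 5]) (use less sub in auto)
  have "card V \<noteq> 0" using less.prems by simp
  then consider "card V = 1" | "card V = 2" | "card V = 3" | "card V = 4"
    using less.prems(3) by linarith
  then show ?case
  proof cases
    case 1 then show ?thesis using rec by (simp add: strong_number_def)
  next
    case 2 
    moreover have "{1..<2} = {1::nat}" by auto
    ultimately show ?thesis using rec by (simp add: strong_number_def)
  next
    case 3
    moreover have "{1..<3} = {1, 2::nat}" by auto
    ultimately show ?thesis using rec by (simp add: strong_number_def)
  next
    case 4
    moreover have "{1..<4} = {1, 2, 3::nat}" by auto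
    ultimately show ?thesis using rec by (simp add: strong_number_def small_binomials)
  qed
qed

lemma card_free_orients_complete_le_5:
  assumes "card V \<le> 5" "V \<noteq> {}" "finite V" "4 \<le> k" "k \<le> 5"
    and "\<And>U. U \<subset> V \<Longrightarrow> card (free_orients k (complete_arcs U)) = f (card U)"
  shows "card (free_orients k (complete_arcs V)) =
    (\<Sum>j\<in>{1..<k}. (card V choose j) * (strong_number j * f (card V - j)))"
  using assms by (intro card_free_orients_complete_rec card_strong_tours) (auto intro: finite_subset)

text \<open>\<open>40 = 4 * 8 + 4 * 2\<close>, from terminal components of 1 and 3 vertices.\<close>

lemma four_free_complete_4:
  assumes "card V = 4"
  shows "card (free_orients 4 (complete_arcs V)) = 40"
proof -
  have fin: "finite V" using assms card.infinite by fastforce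
  have "card (free_orients 4 (complete_arcs V)) = (\<Sum>j\<in>{1..<4}. (card V choose j) *
      (strong_number j * 2 ^ ((card V - j) * (card V - j - 1) div 2)))"
  proof (rule card_free_orients_complete_le_5)
    fix U assume "U \<subset> V"
    then show "card (free_orients 4 (complete_arcs U)) = 2 ^ (card U * (card U - 1) div 2)"
      using assms fin psubset_card_mono[OF fin, of U]
      by (intro card_free_orients_complete_small) (auto intro: finite_subset)
  qed (use assms fin in auto)
  moreover have "{1..<4} = {1, 2, 3::nat}" by auto
  ultimately show ?thesis using assms by (simp add: strong_number_def small_binomials)
qed

text \<open>\<open>240 = 5 * 40 + 10 * 2 * 2\<close>, already below the \<open>2 ^ 8\<close> of the
  Turan graph.\<close>

lemma four_free_complete_5:
  assumes "card V = 5"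
  shows "card (free_orients 4 (complete_arcs V)) = 240"
proof -
  have fin: "finite V" using assms card.infinite by fastforce
  define f :: "nat \<Rightarrow> nat" where "f n = (if n = 4 then 40 else 2 ^ (n * (n - 1) div 2))" for n
  have "card (free_orients 4 (complete_arcs V)) =
      (\<Sum>j\<in>{1..<4}. (card V choose j) * (strong_number j * f (card V - j)))"
  proof (rule card_free_orients_complete_le_5)
    fix U assume "U \<subset> V"
    then have "card U < 5" "finite U" 
      using assms fin psubset_card_mono[OF fin, of U] by (auto intro: finite_subset)
    then show "card (free_orients 4 (complete_arcs U)) = f (card U)"
      using four_free_complete_4[of U] card_free_orients_complete_small[of U 4]
      by (cases "card U = 4") (auto simp: f_def)
  qed (use assms fin in auto)
  moreover have "{1..<4} = {1, 2, 3::nat}" by auto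
  ultimately show ?thesis using assms by (simp add: strong_number_def f_def small_binomials)
qed

text \<open>\<open>480 = 5 * 64 + 10 * 2 * 2 + 5 * 24\<close>, just under half of the
  \<open>1024\<close> tournaments on five vertices.\<close>

lemma five_free_complete_5:
  assumes "card V = 5"
  shows "card (free_orients 5 (complete_arcs V)) = 480"
proof -
  have fin: "finite V" using assms card.infinite by fastforce
  have "card (free_orients 5 (complete_arcs V)) = (\<Sum>j\<in>{1..<5}. (card V choose j) *
      (strong_number j * 2 ^ ((card V - j) * (card V - j - 1) div 2)))"
  proof (rule card_free_orients_complete_le_5)
    fix U assume "U \<subset> V"
    then show "card (free_orients 5 (complete_arcs U)) = 2 ^ (card U * (card U - 1) div 2)"
      using assms fin psubset_card_mono[OF fin, of U]
      by (intro card_free_orients_complete_small) (auto intro: finite_subset)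
  qed (use assms fin in auto)
  moreover have "{1..<5} = {1, 2, 3, 4::nat}" by auto
  ultimately show ?thesis using assms by (simp add: strong_number_def small_binomials)
qed

lemma orients_empty [simp]: "orients {} = {{}}"
  by (auto simp: orients_def)

lemma card_free_orients_empty_le: "card (free_orients k {}) \<le> 1"
proof -
  have "free_orients k {} \<subseteq> {{}}" by (auto simp: free_orients_def)
  from card_mono[OF _ this] show ?thesis by simp
qed

text \<open>
  A strong tournament has two one-vertex extensions that are not strong, and any other one at most
  three quarters of its extensions. The induction cannot start at \<open>k = 4\<close>, where \<open>40\<close> of the \<open>64\<close>
  tournaments are not strong.
\<close>

lemma free_complete_lt_half:
  assumes "5 \<le> k" "card V = k"
  shows "2 * card (free_orients k (complete_arcs V)) < 2 ^ (k * (k - 1) div 2)"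
  using assms
proof (induction k arbitrary: V rule: dec_induct)
  case base
  then show ?case using five_free_complete_5[of V] by simp
next
  case (step k V')
  have fin': "finite V'" using step.prems card.infinite by fastforce
  then obtain v V where V: "V' = insert v V" "v \<notin> V" "card V = k" "finite V"
    using step.prems by (metis card_Suc_eq finite_insert)
  let ?M = "k * (k - 1) div 2"
  let ?B = "free_orients k (complete_arcs V)"
  let ?O = "orients (complete_arcs V)"
  have r: "complete_arcs V' \<inter> V \<times> V = complete_arcs V" "V' - V = {v}"
    "complete_arcs V' \<inter> {v} \<times> {v} = {}" "V \<inter> complete_arcs V' `` {v} = V" using V by auto
  have O: "free_orients (Suc k) (complete_arcs V) = ?O"
    using V step.hyps by (intro free_orients_complete_small) auto
  have finO: "finite ?O" using V by (auto intro: finite_orients)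
  have cardO: "card ?O = 2 ^ ?M"
    using card_orients(1)[OF _ complete_arcs_simple, of V] V by (simp add: card_complete_arcs)
  let ?e = "\<lambda>R. card (extensions (Suc k) (complete_arcs V') R v V)"
  have cl: "clique_in (complete_arcs V') V" using V by (intro clique_in_complete) auto
  have e1: "?e R \<le> 3 * 2 ^ (k - 2)" if "R \<in> ?O" for R
  proof -
    have "?e R \<le> ext_bound (Suc k) (card V)"
    proof (rule card_extensions_le[of _ _ _ V])
      show "R \<in> free_orients (Suc k) (complete_arcs V' \<inter> V \<times> V)" using that r(1) O by simp
    qed (use V cl step in auto)
    also have "\<dots> = 3 * 2 ^ (k - 2)" using V step.hyps by (simp add: ext_bound_def)
    finally show ?thesis .
  qed
  have e2: "?e R \<le> 2" if R: "R \<in> ?O - ?B" for R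
  proof (rule card_extensions_strong[of _ V])
    obtain W where W: "card W = k" "clique_in (complete_arcs V) W" "strong_on R W"
      using R unfolding free_orients_def by blast
    then have "W \<subseteq> V" using clique_in_complete_iff[of W V] step.hyps by simp
    then have "W = V" using W V by (metis card_subset_eq)
    then show "strong_on R V" using W by simp
  qed (use R V cl in \<open>auto simp: orients_def\<close>)
  have "card (free_orients (Suc k) (complete_arcs V')) \<le>
      (\<Sum>R\<in>?O. ?e R) * card (free_orients (Suc k) ({} :: 'a rel))"
    using card_free_orients_le[of V' "complete_arcs V'" V "Suc k"] fin' V r O step.hyps
      complete_arcs_simple(1)[of V'] by auto
  also have "\<dots> \<le> (\<Sum>R\<in>?O. ?e R)" using card_free_orients_empty_le by (metis mult_le_mono2 mult.right_neutral)
  also have "\<dots> = (\<Sum>R\<in>?B. ?e R) + (\<Sum>R\<in>?O - ?B. ?e R)"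
    using finO by (subst sum.subset_diff[of ?B]) (auto simp: free_orients_def)
  also have "\<dots> \<le> card ?B * (3 * 2 ^ (k - 2)) + card (?O - ?B) * 2"
    using e1 e2 sum_bounded_above[of ?B ?e "3 * 2 ^ (k - 2)"] sum_bounded_above[of "?O - ?B" ?e 2]
    by (intro add_mono) (auto simp: free_orients_def)
  also have "card (?O - ?B) * 2 \<le> 2 ^ ?M * 2"
    using card_mono[OF finO, of "?O - ?B"] cardO by simp
  finally have "2 * card (free_orients (Suc k) (complete_arcs V')) \<le>
      2 * card ?B * (3 * 2 ^ (k - 2)) + 2 ^ ?M * 4" by simp
  also have "\<dots> \<le> 2 ^ ?M * (3 * 2 ^ (k - 2)) + 2 ^ ?M * 4"
    using step.IH[OF V(3)] by (intro add_right_mono mult_right_mono) auto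
  also have "\<dots> = 2 ^ ?M * (3 * 2 ^ (k - 2) + 4)" by (simp add: algebra_simps)
  \<comment> \<open>The step needs \<open>3 * 2 ^ (k - 2) + 4 < 4 * 2 ^ (k - 2)\<close>, which holds
    for \<open>k \<ge> 5\<close>.\<close>
  also have "\<dots> < 2 ^ ?M * 2 ^ k"
  proof -
    have "2 ^ 3 \<le> (2::nat) ^ (k - 2)" using step.hyps by (intro power_increasing) auto
    moreover have "(2::nat) ^ k = 4 * 2 ^ (k - 2)"
    proof -
      have "k = 2 + (k - 2)" using step.hyps by linarith
      then have "(2::nat) ^ k = 2 ^ (2 + (k - 2))" by (rule arg_cong)
      also have "\<dots> = 4 * 2 ^ (k - 2)" unfolding power_add by simp
      finally show ?thesis .
    qed
    ultimately show ?thesis by simp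
  qed
  also have "2 ^ ?M * 2 ^ k = (2::nat) ^ (Suc k * (Suc k - 1) div 2)"
  proof -
    have "Suc k * (Suc k - 1) div 2 = (k * (k - 1) + 2 * k) div 2"
      by (cases k) (auto simp: algebra_simps)
    also have "\<dots> = ?M + k" by simp
    finally show ?thesis by (simp add: power_add)
  qed
  finally show ?case .
qed

section \<open>Extremal clique-free graphs\<close>

text \<open>The complete multipartite graph whose parts are the colour classes.\<close>

definition color_arcs :: "'a set \<Rightarrow> ('a \<Rightarrow> nat) \<Rightarrow> 'a rel" where
  "color_arcs V c = {(u, v). u \<in> V \<and> v \<in> V \<and> c u \<noteq> c v}"

lemma finite_color_arcs: "finite V \<Longrightarrow> finite (color_arcs V c)"
  by (rule finite_subset[of _ "V \<times> V"]) (auto simp: color_arcs_def)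

text \<open>
  Colour the non-neighbours of a vertex of maximum degree with a new colour and recurse on its
  neighbourhood.
\<close>

lemma clique_free_le_color_arcs:
  assumes "finite V" "E \<subseteq> V \<times> V" "sym E" "irrefl E"
    "\<And>W. W \<subseteq> V \<Longrightarrow> clique_in E W \<Longrightarrow> card W \<noteq> Suc r"
  shows "\<exists>c. (\<forall>v\<in>V. c v < r) \<and> card E \<le> card (color_arcs V c) \<and>
    (card E = card (color_arcs V c) \<longrightarrow> E = color_arcs V c)"
  using assms
proof (induction r arbitrary: V E)
  case 0
  have "V = {}"
  proof (rule ccontr)
    assume "V \<noteq> {}"
    then obtain v where "v \<in> V" by blast
    then show False using "0.prems"(5)[of "{v}"] by (simp add: clique_in_def)
  qed
  then show ?case using 0 by (auto simp: color_arcs_def)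
next
  case (Suc r)
  show ?case
  proof (cases "V = {}")
    case True
    then show ?thesis using Suc by (auto simp: color_arcs_def)
  next
    case False
    define deg where "deg u = card (E `` {u})" for u
    have "Max (deg ` V) \<in> deg ` V" using Suc.prems(1) False by (intro Max_in) auto
    then obtain v where v: "v \<in> V" "deg v = Max (deg ` V)" by auto
    have degv: "deg u \<le> deg v" if "u \<in> V" for u
      using that Suc.prems(1) v(2) by simp
    define A where "A = E `` {v}"
    define B where "B = V - A"
    have AV: "A \<subseteq> V" using Suc.prems(2) by (auto simp: A_def)
    have fin: "finite A" "finite B" "finite E"
      using Suc.prems(1,2) AV by (auto simp: B_def intro: finite_subset)
    have "card W \<noteq> Suc r" if W: "W \<subseteq> A" "clique_in (E \<inter> A \<times> A) W" for W
    proof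
      assume card: "card W = Suc r"
      have vE: "(v, w) \<in> E" "(w, v) \<in> E" if "w \<in> W" for w
        using that W(1) Suc.prems(3) by (auto simp: A_def dest: symD)
      have clW: "clique_in E W" using W unfolding clique_in_def by blast
      have "v \<notin> W" using W(1) Suc.prems(4) by (auto simp: A_def irrefl_def)
      have "clique_in E (insert v W)" using clW vE unfolding clique_in_def by blast
      moreover have "card (insert v W) = Suc (Suc r)"
        using \<open>v \<notin> W\<close> card by (simp add: card_ge_0_finite)
      moreover have "insert v W \<subseteq> V" using v W AV by blast
      ultimately show False using Suc.prems(5) by blast
    qed
    moreover have "sym (E \<inter> A \<times> A)" "irrefl (E \<inter> A \<times> A)"
      using Suc.prems(3,4) unfolding sym_def irrefl_def by blast+
    ultimately obtain c' where c': "\<forall>u\<in>A. c' u < r" "card (E \<inter> A \<times> A) \<le> card (color_arcs A c')"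
        "card (E \<inter> A \<times> A) = card (color_arcs A c') \<longrightarrow> E \<inter> A \<times> A = color_arcs A c'"
      using Suc.IH[of A "E \<inter> A \<times> A"] fin by blast
    define c where "c u = (if u \<in> A then c' u else r)" for u
    have col: "color_arcs V c = color_arcs A c' \<union> A \<times> B \<union> B \<times> A"
      using AV c'(1) unfolding color_arcs_def B_def c_def by auto
    have cardc: "card (color_arcs V c) = card (color_arcs A c') + card A * card B + card A * card B"
      unfolding col using fin
      by (subst card_Un_disjoint; (subst card_Un_disjoint)?)
        (auto simp: card_cartesian_product B_def color_arcs_def finite_color_arcs
          intro!: finite_color_arcs[unfolded color_arcs_def])
    \<comment> \<open>There are at most \<open>card A * card B\<close> arcs from \<open>A\<close> to
      \<open>B\<close>, and arcs starting in \<open>B\<close> number at most \<open>card B\<close>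
      times the maximum degree \<open>card A\<close>. The colouring attains both bounds.\<close>
    have split: "E = E \<inter> A \<times> A \<union> E \<inter> A \<times> B \<union> E \<inter> B \<times> V"
      using Suc.prems(2) AV by (auto simp: B_def)
    have "card E = card (E \<inter> A \<times> A \<union> E \<inter> A \<times> B \<union> E \<inter> B \<times> V)"
      using split by (rule arg_cong)
    also have "\<dots> = card (E \<inter> A \<times> A \<union> E \<inter> A \<times> B) + card (E \<inter> B \<times> V)"
      using fin by (intro card_Un_disjoint) (auto simp: B_def)
    also have "card (E \<inter> A \<times> A \<union> E \<inter> A \<times> B) = card (E \<inter> A \<times> A) + card (E \<inter> A \<times> B)"
      using fin by (intro card_Un_disjoint) (auto simp: B_def)
    finally have cardE: "card E = card (E \<inter> A \<times> A) + card (E \<inter> A \<times> B) + card (E \<inter> B \<times> V)" .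
    have AB: "card (E \<inter> A \<times> B) \<le> card A * card B"
      using fin by (subst card_cartesian_product[symmetric]) (intro card_mono, auto)
    have "E \<inter> B \<times> V = (SIGMA b:B. E `` {b})" using Suc.prems(2) by auto
    then have "card (E \<inter> B \<times> V) = (\<Sum>b\<in>B. deg b)"
      using fin by (simp add: card_SigmaI deg_def)
    also have "\<dots> \<le> (\<Sum>b\<in>B. deg v)" using degv by (intro sum_mono) (auto simp: B_def)
    finally have BV: "card (E \<inter> B \<times> V) \<le> card A * card B" by (simp add: deg_def A_def mult.commute)
    have "E = color_arcs V c" if eq: "card E = card (color_arcs V c)"
    proof -
      have eqs: "card (E \<inter> A \<times> A) = card (color_arcs A c')" "card (E \<inter> A \<times> B) = card A * card B"
          "card (E \<inter> B \<times> V) = card A * card B"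
        using eq cardE cardc c'(2) AB BV by linarith+
      have 1: "E \<inter> A \<times> A = color_arcs A c'" using c'(3) eqs by blast
      have 2: "E \<inter> A \<times> B = A \<times> B"
        using eqs fin by (intro card_subset_eq) (auto simp: card_cartesian_product)
      have "B \<times> A \<subseteq> E" using 2 Suc.prems(3) by (auto dest: symD)
      then have "B \<times> A = E \<inter> B \<times> V"
        using eqs fin AV by (intro card_subset_eq) (auto simp: card_cartesian_product)
      then show ?thesis using split 1 2 col by simp
    qed
    moreover have "\<forall>u\<in>V. c u < Suc r" using c'(1) by (auto simp: c_def less_SucI)
    ultimately show ?thesis using cardE cardc c'(2) AB BV by (intro exI[of _ c]) auto
  qed
qed

lemma sum_color_classes:
  assumes "finite V" "\<forall>v\<in>V. c v < r"
  shows "(\<Sum>i<r. card {v \<in> V. c v = i}) = card V"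
    and "card (color_arcs V c) + (\<Sum>i<r. (card {v \<in> V. c v = i})\<^sup>2) = (card V)\<^sup>2"
proof -
  let ?C = "\<lambda>i. {v \<in> V. c v = i}"
  have "(\<Union>i<r. ?C i) = V" using assms by auto
  then have "card V = card (\<Union>i<r. ?C i)" by simp
  also have "\<dots> = (\<Sum>i<r. card (?C i))" using assms by (intro card_UN_disjoint) auto
  finally show "(\<Sum>i<r. card (?C i)) = card V" ..
  have "V \<times> V = color_arcs V c \<union> (\<Union>i<r. ?C i \<times> ?C i)"
    using assms by (auto simp: color_arcs_def)
  then have "card (V \<times> V) = card (color_arcs V c \<union> (\<Union>i<r. ?C i \<times> ?C i))" by (rule arg_cong)
  also have "\<dots> = card (color_arcs V c) + card (\<Union>i<r. ?C i \<times> ?C i)"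
    using assms by (intro card_Un_disjoint) (auto simp: finite_color_arcs, auto simp: color_arcs_def)
  also have "card (\<Union>i<r. ?C i \<times> ?C i) = (\<Sum>i<r. (card (?C i))\<^sup>2)"
    using assms by (subst card_UN_disjoint) (auto simp: card_cartesian_product power2_eq_square)
  finally show "card (color_arcs V c) + (\<Sum>i<r. (card (?C i))\<^sup>2) = (card V)\<^sup>2"
    by (simp add: card_cartesian_product power2_eq_square)
qed

lemma ex_bij_preserving_colors:
  assumes V: "finite V" "\<forall>v\<in>V. c v < r" and T: "finite T" "\<forall>v\<in>T. d v < r"
    and \<pi>: "bij_betw \<pi> {..<r} {..<r}"
    and sizes: "\<And>i. i < r \<Longrightarrow> card {v \<in> V. c v = i} = card {v \<in> T. d v = \<pi> i}"
  shows "\<exists>f. bij_betw f V T \<and> (\<forall>v\<in>V. d (f v) = \<pi> (c v))"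
proof -
  have "\<forall>i\<in>{..<r}. \<exists>g. bij_betw g {v \<in> V. c v = i} {v \<in> T. d v = \<pi> i}"
    using V T sizes by (auto intro!: finite_same_card_bij)
  then obtain g where g: "\<And>i. i < r \<Longrightarrow> bij_betw (g i) {v \<in> V. c v = i} {v \<in> T. d v = \<pi> i}"
    by (metis lessThan_iff)
  define f where "f v = g (c v) v" for v
  have f: "f v \<in> T" "d (f v) = \<pi> (c v)" if "v \<in> V" for v
    using g[of "c v"] V that unfolding f_def by (auto dest: bij_betwE)
  have "inj_on f V"
  proof (rule inj_onI)
    fix u v assume uv: "u \<in> V" "v \<in> V" "f u = f v"
    then have "\<pi> (c u) = \<pi> (c v)" using f by metis
    then have "c u = c v" using \<pi> V uv by (auto simp: bij_betw_def dest: inj_onD)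
    then show "u = v" using uv g[of "c v"] V unfolding f_def bij_betw_def
      by (auto dest: inj_onD)
  qed
  moreover have "f ` V = T"
  proof
    show "T \<subseteq> f ` V"
    proof
      fix t assume t: "t \<in> T"
      then obtain i where i: "i < r" "\<pi> i = d t" using \<pi> T unfolding bij_betw_def by (metis imageE lessThan_iff)
      have "t \<in> g i ` {v \<in> V. c v = i}"
        using bij_betw_imp_surj_on[OF g[OF i(1)]] t i(2) by simp
      then obtain v where "v \<in> V" "c v = i" "g i v = t" by auto
      then show "t \<in> f ` V" unfolding f_def by blast
    qed
  qed (use f in auto)
  ultimately show ?thesis using f by (auto simp: bij_betw_def)
qed

text \<open>Used to rename colours so that the larger classes \<open>A\<close> of one balanced
  colouring go to the larger classes \<open>B\<close> of another.\<close>

lemma ex_perm_matching: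
  assumes "A \<subseteq> {..<r}" "B \<subseteq> {..<r}" "card A = card B"
  shows "\<exists>\<pi>. bij_betw \<pi> {..<r::nat} {..<r} \<and> (\<forall>i<r. \<pi> i \<in> B \<longleftrightarrow> i \<in> A)"
proof -
  have fin: "finite A" "finite B" using assms finite_subset by blast+
  obtain p where p: "bij_betw p A B" using finite_same_card_bij[OF fin assms(3)] by blast
  have "card ({..<r} - A) = card ({..<r} - B)" using assms fin by (simp add: card_Diff_subset)
  then obtain q where q: "bij_betw q ({..<r} - A) ({..<r} - B)"
    using finite_same_card_bij[of "{..<r} - A" "{..<r} - B"] by blast
  define \<pi> where "\<pi> i = (if i \<in> A then p i else q i)" for i
  have "bij_betw \<pi> (A \<union> ({..<r} - A)) (B \<union> ({..<r} - B))"
    using bij_betw_disjoint_Un[OF p q] unfolding \<pi>_def by auto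
  moreover have "A \<union> ({..<r} - A) = {..<r}" "B \<union> ({..<r} - B) = {..<r}" using assms by auto
  moreover have "\<pi> i \<in> B \<longleftrightarrow> i \<in> A" if "i < r" for i
    using that p q unfolding \<pi>_def by (auto dest: bij_betwE)
  ultimately show ?thesis by auto
qed

section \<open>The Turan graph and its number of edges\<close>

lemma parcs_turan_graph: "parcs (turan_graph r n) = color_arcs {..<n} (\<lambda>v. v mod r)"
  by (auto simp: turan_graph_def color_arcs_def)

text \<open>
  Both colourings are compared through \<open>\<Sum>i. (n\<^sub>i - q) (n\<^sub>i - q - 1)\<close>, a sum of nonnegative
  integers that vanishes for the Turan graph when \<open>q\<close> is its smallest class size.
\<close>

lemma color_arcs_le_turan:
  assumes V: "finite V" "\<forall>v\<in>V. c v < r" and r: "0 < r"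
  defines "n \<equiv> card V"
  shows "card (color_arcs V c) \<le> card (parcs (turan_graph r n))"
    and "card (color_arcs V c) = card (parcs (turan_graph r n)) \<Longrightarrow>
      \<exists>f. bij_betw f V {..<n} \<and> (\<forall>u\<in>V. \<forall>v\<in>V. c u \<noteq> c v \<longleftrightarrow> f u mod r \<noteq> f v mod r)"
proof -
  define a where "a i = card {v \<in> V. c v = i}" for i
  define b where "b i = card {v \<in> {..<n}. v mod r = i}" for i
  define q where "q = Min (b ` {..<r})"
  have q: "b i = q \<or> b i = Suc q" if "i < r" for i
  proof -
    have "q \<in> b ` {..<r}" unfolding q_def using r by (intro Min_in) auto
    then obtain j where j: "j < r" "b j = q" by auto
    have "q \<le> b i" unfolding q_def using that by (intro Min_le) auto
    moreover have "b i \<le> b j + 1"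
      using turan_graph_parts_balanced[OF that j(1), of n] by (simp add: b_def)
    ultimately show ?thesis using j by linarith
  qed
  define D where "D f = (\<Sum>i<r. (int (f i) - int q) * (int (f i) - int q - 1))" for f
  have nonneg: "(x - int q) * (x - int q - 1) \<ge> 0" for x
    by (cases "x \<le> int q") (auto intro: mult_nonpos_nonpos mult_nonneg_nonneg)
  have expand: "D f = int (\<Sum>i<r. (f i)\<^sup>2) - (2 * int q + 1) * int (\<Sum>i<r. f i) + int r * (int q * (int q + 1))"
    for f :: "nat \<Rightarrow> nat"
  proof -
    have "D f = (\<Sum>i<r. (int (f i))\<^sup>2 - (2 * int q + 1) * int (f i) + int q * (int q + 1))"
      unfolding D_def by (intro sum.cong) (auto simp: algebra_simps power2_eq_square)
    then show ?thesis by (simp add: sum.distrib sum_subtractf sum_distrib_left)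
  qed
  have Tn: "\<forall>v\<in>{..<n}. v mod r < r" using r by simp
  note sa = sum_color_classes[OF V, folded a_def n_def]
  note sb = sum_color_classes[OF finite_lessThan Tn, folded b_def parcs_turan_graph, unfolded card_lessThan]
  have "D b = 0" unfolding D_def using q by (intro sum.neutral) force
  \<comment> \<open>The class sizes sum to \<open>n\<close> in both colourings, so \<open>D\<close>
    differs from the sum of their squares by a common constant, and the arcs number
    \<open>n\<^sup>2\<close> minus that sum.\<close>
  moreover have "int (card (color_arcs V c)) + D a = int (card (parcs (turan_graph r n))) + D b"
    using arg_cong[OF sa(2), of int] arg_cong[OF sb(2), of int] unfolding expand sa(1) sb(1)
    by (simp add: algebra_simps)
  ultimately have main: "int (card (color_arcs V c)) + D a = int (card (parcs (turan_graph r n)))"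
    by simp
  have "D a \<ge> 0" unfolding D_def using nonneg by (intro sum_nonneg) auto
  then show "card (color_arcs V c) \<le> card (parcs (turan_graph r n))" using main by linarith
  assume "card (color_arcs V c) = card (parcs (turan_graph r n))"
  then have "D a = 0" using main by simp
  then have zero: "(int (a i) - int q) * (int (a i) - int q - 1) = 0" if "i < r" for i
    using that nonneg unfolding D_def by (subst (asm) sum_nonneg_eq_0_iff) auto
  have aq: "a i = q \<or> a i = Suc q" if "i < r" for i
    using zero[OF that] by auto
  define I where "I f = {i. i < r \<and> f i = Suc q}" for f :: "nat \<Rightarrow> nat"
  have cardI: "card (I f) + r * q = (\<Sum>i<r. f i)" if "\<And>i. i < r \<Longrightarrow> f i = q \<or> f i = Suc q" for f
  proof -
    have "(\<Sum>i<r. f i) = (\<Sum>i<r. q + (if f i = Suc q then 1 else 0))"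
      using that by (intro sum.cong) force+
    also have "\<dots> = r * q + card (I f)"
    proof -
      have "I f = {..<r} \<inter> {i. f i = Suc q}" by (auto simp: I_def)
      then show ?thesis by (simp add: sum.distrib sum.If_cases)
    qed
    finally show ?thesis by simp
  qed
  \<comment> \<open>All sizes are \<open>q\<close> or \<open>Suc q\<close> and both families sum to
    \<open>n\<close>, which fixes the number of larger classes.\<close>
  have "card (I a) = card (I b)" using cardI[of a, OF aq] cardI[of b, OF q] sa(1) sb(1) by linarith
  then obtain \<pi> where \<pi>: "bij_betw \<pi> {..<r} {..<r}" "\<And>i. i < r \<Longrightarrow> \<pi> i \<in> I b \<longleftrightarrow> i \<in> I a"
    using ex_perm_matching[of "I a" r "I b"] by (auto simp: I_def)
  have pr: "\<pi> i < r" if "i < r" for i using \<pi>(1) that by (auto dest: bij_betwE)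
  have "a i = b (\<pi> i)" if "i < r" for i
    using \<pi>(2)[OF that] aq[OF that] q[OF pr[OF that]] pr[OF that] that by (auto simp: I_def)
  then obtain f where f: "bij_betw f V {..<n}" "\<And>v. v \<in> V \<Longrightarrow> f v mod r = \<pi> (c v)"
    using ex_bij_preserving_colors[OF V finite_lessThan Tn \<pi>(1)] unfolding a_def b_def by blast
  have "\<pi> (c u) = \<pi> (c v) \<longleftrightarrow> c u = c v" if "u \<in> V" "v \<in> V" for u v
    using that V(2) \<pi>(1) unfolding bij_betw_def by (auto dest: inj_onD)
  then show "\<exists>f. bij_betw f V {..<n} \<and> (\<forall>u\<in>V. \<forall>v\<in>V. c u \<noteq> c v \<longleftrightarrow> f u mod r \<noteq> f v mod r)"
    using f by (intro exI[of _ f]) auto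
qed

lemma turan_graph_simple:
  "finite (parcs (turan_graph r n))" "parcs (turan_graph r n) \<subseteq> {..<n} \<times> {..<n}"
  "sym (parcs (turan_graph r n))" "irrefl (parcs (turan_graph r n))"
  unfolding parcs_turan_graph
  by (rule finite_color_arcs) (auto simp: color_arcs_def sym_def irrefl_def)

text \<open>One arc per edge: it counts edges, and it is the reference orientation fed to
  \<open>orients_half\<close>.\<close>

definition turan_up_arcs :: "nat \<Rightarrow> nat \<Rightarrow> nat rel" where
  "turan_up_arcs r n = {(u, v). u < v \<and> v < n \<and> u mod r \<noteq> v mod r}"

lemma turan_number_eq_card: "turan_number r n = card (turan_up_arcs r n)"
proof -
  have "edges_of (turan_graph r n) = (\<lambda>(u, v). {u, v}) ` turan_up_arcs r n"
  proof (intro equalityI subsetI)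
    fix e assume "e \<in> edges_of (turan_graph r n)"
    then obtain u v where e: "e = {u, v}" "u < n" "v < n" "u mod r \<noteq> v mod r"
      by (auto simp: edges_of_def turan_graph_def)
    then have "(u, v) \<in> turan_up_arcs r n \<or> (v, u) \<in> turan_up_arcs r n"
      unfolding turan_up_arcs_def by (auto simp: neq_iff)
    then show "e \<in> (\<lambda>(u, v). {u, v}) ` turan_up_arcs r n"
      using e(1) by (auto simp: image_iff insert_commute intro: bexI[rotated])
  next
    fix e assume "e \<in> (\<lambda>(u, v). {u, v}) ` turan_up_arcs r n"
    then obtain u v where "e = {u, v}" "(u, v) \<in> parcs (turan_graph r n)"
      by (auto simp: turan_graph_def turan_up_arcs_def)
    then show "e \<in> edges_of (turan_graph r n)" unfolding edges_of_def by blast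
  qed
  moreover have "inj_on (\<lambda>(u, v). {u, v}) (turan_up_arcs r n)"
    by (rule inj_onI) (auto simp: turan_up_arcs_def doubleton_eq_iff)
  ultimately show ?thesis unfolding turan_number_def by (simp add: card_image)
qed

lemma card_parcs_turan_graph: "card (parcs (turan_graph r n)) = 2 * turan_number r n"
proof -
  have "(u, v) \<in> turan_up_arcs r n \<longleftrightarrow> (v, u) \<notin> turan_up_arcs r n"
    if "(u, v) \<in> parcs (turan_graph r n)" for u v
  proof -
    have "u < n" "v < n" "u mod r \<noteq> v mod r" using that by (simp_all add: turan_graph_def)
    then show ?thesis by (cases u v rule: linorder_cases) (simp_all add: turan_up_arcs_def)
  qed
  moreover have "turan_up_arcs r n \<subseteq> parcs (turan_graph r n)"
    by (auto simp: turan_up_arcs_def turan_graph_def)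
  ultimately have "turan_up_arcs r n \<in> orients (parcs (turan_graph r n))"
    unfolding orients_def by blast
  from orients_half(1)[OF turan_graph_simple(1,3) this] show ?thesis
    by (simp add: turan_number_eq_card)
qed

lemma turan_number_0 [simp]: "turan_number r 0 = 0"
  by (simp add: turan_number_eq_card turan_up_arcs_def)

lemma card_residue_class:
  assumes "0 < r"
  shows "card {u. u < n \<and> u mod r = n mod r} = n div r"
proof -
  have "{u. u < n \<and> u mod r = n mod r} = (\<lambda>j. j * r + n mod r) ` {..<n div r}"
  proof (intro equalityI subsetI)
    fix u assume "u \<in> {u. u < n \<and> u mod r = n mod r}"
    then have u: "u < n" "u mod r = n mod r" by auto
    have ueq: "u = u div r * r + n mod r" using u(2) by (metis div_mult_mod_eq)
    have "n = n div r * r + n mod r" by simp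
    then have "u div r * r < n div r * r" using ueq u(1) by linarith
    then have "u div r < n div r" by simp
    then show "u \<in> (\<lambda>j. j * r + n mod r) ` {..<n div r}" using ueq by blast
  next
    fix u assume "u \<in> (\<lambda>j. j * r + n mod r) ` {..<n div r}"
    then obtain j where j: "j < n div r" "u = j * r + n mod r" by auto
    have "j * r < n div r * r" using j assms by simp
    then have "u < n" using div_mult_mod_eq[of n r] j(2) by linarith
    then show "u \<in> {u. u < n \<and> u mod r = n mod r}" using j by simp
  qed
  moreover have "inj_on (\<lambda>j. j * r + n mod r) {..<n div r}" using assms by (auto simp: inj_on_def)
  ultimately show ?thesis by (simp add: card_image)
qed

text \<open>The new vertex \<open>n\<close> misses exactly the \<open>n div r\<close> earlier
  members of its residue class. All later arithmetic on Turan numbers rests on this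
  recursion.\<close>

lemma turan_number_Suc:
  assumes "0 < r"
  shows "turan_number r (Suc n) = turan_number r n + (n - n div r)"
proof -
  let ?N = "{u. u < n \<and> u mod r \<noteq> n mod r}"
  have "turan_up_arcs r (Suc n) = turan_up_arcs r n \<union> (\<lambda>u. (u, n)) ` ?N"
    by (auto simp: turan_up_arcs_def less_Suc_eq)
  moreover have "finite (turan_up_arcs r n)"
    by (rule finite_subset[of _ "{..<n} \<times> {..<n}"]) (auto simp: turan_up_arcs_def)
  ultimately have "turan_number r (Suc n) = turan_number r n + card ((\<lambda>u. (u, n)) ` ?N)"
    unfolding turan_number_eq_card by (subst card_Un_disjoint[symmetric]) (auto simp: turan_up_arcs_def)
  also have "card ((\<lambda>u. (u, n)) ` ?N) = card ?N" by (intro card_image) (auto simp: inj_on_def)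
  also have "?N = {..<n} - {u. u < n \<and> u mod r = n mod r}" by auto
  also have "card \<dots> = n - n div r"
    using card_residue_class[OF assms, of n] by (subst card_Diff_subset) auto
  finally show ?thesis .
qed

text \<open>The factor 2 appears because \<open>E\<close> holds each edge in both
  directions.\<close>

theorem turan:
  assumes "finite V" "E \<subseteq> V \<times> V" "sym E" "irrefl E" "0 < r"
    and "\<And>W. W \<subseteq> V \<Longrightarrow> clique_in E W \<Longrightarrow> card W \<noteq> Suc r"
  shows "card E \<le> 2 * turan_number r (card V)"
    and "card E = 2 * turan_number r (card V) \<Longrightarrow>
      \<exists>f. bij_betw f V {..<card V} \<and> (\<forall>u\<in>V. \<forall>v\<in>V. (u, v) \<in> E \<longleftrightarrow> f u mod r \<noteq> f v mod r)"
proof -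
  obtain c where c: "\<forall>v\<in>V. c v < r" "card E \<le> card (color_arcs V c)"
      "card E = card (color_arcs V c) \<Longrightarrow> E = color_arcs V c"
    using clique_free_le_color_arcs[OF assms(1,2,3,4,6)] by blast
  note T = color_arcs_le_turan[OF assms(1) c(1) assms(5), unfolded card_parcs_turan_graph]
  show "card E \<le> 2 * turan_number r (card V)" using c(2) T(1) by linarith
  assume "card E = 2 * turan_number r (card V)"
  then have "card E = card (color_arcs V c)" "card (color_arcs V c) = 2 * turan_number r (card V)"
    using c(2) T(1) by auto
  then show "\<exists>f. bij_betw f V {..<card V} \<and>
      (\<forall>u\<in>V. \<forall>v\<in>V. (u, v) \<in> E \<longleftrightarrow> f u mod r \<noteq> f v mod r)"
    using c(3) T(2) by (auto simp: color_arcs_def)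
qed

section \<open>Numerical estimates\<close>

lemma ext_bound_Suc: "3 \<le> k \<Longrightarrow> ext_bound k d \<le> ext_bound k (Suc d)"
proof -
  assume k: "3 \<le> k"
  consider "d + 3 \<le> k" | "d + 2 = k" | "k < d + 2" by linarith
  then show ?thesis
  proof cases
    case 2
    then have "d = Suc (k - 3)" using k by simp
    then show ?thesis using 2 k by (simp add: ext_bound_def)
  qed (auto simp: ext_bound_def)
qed

lemma ext_bound_mono: "a \<le> b \<Longrightarrow> 3 \<le> k \<Longrightarrow> ext_bound k a \<le> ext_bound k b"
  by (induction b rule: dec_induct) (auto intro: order_trans[OF _ ext_bound_Suc])

text \<open>The neighbours in \<open>W\<close> of an outside vertex again form a clique, so
  \<open>card_extensions_le\<close> bounds every factor of the product by the same number.\<close>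

lemma card_free_orients_clique_le:
  assumes V: "finite V" "E \<subseteq> V \<times> V" "sym E" "irrefl E"
    and W: "W \<subseteq> V" "clique_in E W" and k: "3 \<le> k"
    and deg: "\<And>v. v \<in> V - W \<Longrightarrow> card (W \<inter> E `` {v}) \<le> d"
  shows "card (free_orients k E) \<le> card (free_orients k (complete_arcs W)) *
    ext_bound k d ^ card (V - W) * card (free_orients k (E \<inter> (V - W) \<times> (V - W)))"
proof -
  have EW: "E \<inter> W \<times> W = complete_arcs W"
    using W V(4) unfolding clique_in_def irrefl_def by auto
  have "(\<Prod>v\<in>V - W. card (extensions k E R v (W \<inter> E `` {v}))) \<le> ext_bound k d ^ card (V - W)"
    if R: "R \<in> free_orients k (complete_arcs W)" for R
  proof -
    have "card (extensions k E R v (W \<inter> E `` {v})) \<le> ext_bound k d" if v: "v \<in> V - W" for v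
    proof -
      have "card (extensions k E R v (W \<inter> E `` {v})) \<le> ext_bound k (card (W \<inter> E `` {v}))"
      proof (rule card_extensions_le[where W = W])
        show "R \<in> free_orients k (E \<inter> W \<times> W)" using R EW by simp
        show "finite (W \<inter> E `` {v})" using W V finite_subset by blast
        show "clique_in E (W \<inter> E `` {v})" using W(2) clique_in_subset by blast
      qed (use v k in auto)
      also have "\<dots> \<le> ext_bound k d" using deg[OF v] k ext_bound_mono by blast
      finally show ?thesis .
    qed
    then show ?thesis
      using prod_mono[of "V - W" "\<lambda>v. card (extensions k E R v (W \<inter> E `` {v}))" "\<lambda>_. ext_bound k d"]
      by simp
  qed
  then have "(\<Sum>R\<in>free_orients k (complete_arcs W).
      \<Prod>v\<in>V - W. card (extensions k E R v (W \<inter> E `` {v}))) \<le>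
      card (free_orients k (complete_arcs W)) * ext_bound k d ^ card (V - W)"
    using sum_bounded_above[of "free_orients k (complete_arcs W)" _ "ext_bound k d ^ card (V - W)"]
    by simp
  moreover have "2 \<le> k" using k by simp
  ultimately show ?thesis
    using order_trans[OF card_free_orients_le[OF V(1-3) W(1), of k] mult_le_mono1]
    unfolding EW by blast
qed

lemma card_free_orients_complete_insert:
  assumes "finite W" "v \<notin> W" "3 \<le> k"
  shows "card (free_orients k (complete_arcs (insert v W))) \<le>
    card (free_orients k (complete_arcs W)) * ext_bound k (card W)"
proof -
  have "card (W \<inter> complete_arcs (insert v W) `` {u}) \<le> card W" for u
    using assms by (intro card_mono) auto
  then have "card (free_orients k (complete_arcs (insert v W))) \<le>
      card (free_orients k (complete_arcs W)) * ext_bound k (card W) ^ card (insert v W - W) *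
      card (free_orients k (complete_arcs (insert v W) \<inter> (insert v W - W) \<times> (insert v W - W)))"
    using assms by (intro card_free_orients_clique_le clique_in_complete complete_arcs_simple) auto
  moreover have "insert v W - W = {v}" "complete_arcs (insert v W) \<inter> {v} \<times> {v} = {}"
    using assms by auto
  ultimately have "card (free_orients k (complete_arcs (insert v W))) \<le>
      card (free_orients k (complete_arcs W)) * ext_bound k (card W) * card (free_orients k ({} :: 'a rel))"
    by (simp only:) simp
  also have "\<dots> \<le> card (free_orients k (complete_arcs W)) * ext_bound k (card W) * 1"
    by (intro mult_le_mono2 card_free_orients_empty_le)
  finally show ?thesis by simp
qed

text \<open>Three steps in \<open>j\<close> add 2 to the exponent and so quadruple the right-hand
  side; at \<open>j = 0\<close> both sides are 4. The factor \<open>j + 4\<close> comes from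
  \<open>ext_bound k (k + j)\<close>.\<close>

lemma add_4_le_power: "j + 4 \<le> (2::nat) ^ (j + 2 - (j + 1) div 3)"
proof (induction j rule: less_induct)
  case (less j)
  consider "j = 0" | "j = 1" | "j = 2" | i where "j = i + 3"
  proof (cases "j < 3")
    case True
    then have "j = 0 \<or> j = 1 \<or> j = 2" by auto
    then show ?thesis using that by blast
  next
    case False
    then show ?thesis using that(4)[of "j - 3"] by simp
  qed
  then show ?case
  proof cases
    case (4 i)
    have "(j + 1) div 3 = (i + 1) div 3 + 1" using 4 by simp
    then have "j + 2 - (j + 1) div 3 = (i + 2 - (i + 1) div 3) + 2" using 4 by simp
    then have "(2::nat) ^ (j + 2 - (j + 1) div 3) = 4 * 2 ^ (i + 2 - (i + 1) div 3)"
      by (simp add: power_add)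
    then show ?thesis using less[of i] 4 by linarith
  qed simp_all
qed

text \<open>By \<open>turan_number_Suc\<close> the right-hand side counts the orientations of the
  edges from vertex \<open>w\<close> of the Turan graph to the earlier ones; \<open>k = 4\<close> is
  the worst case. The inequality fails at \<open>w = k - 1\<close>, so maximum cliques of exactly
  \<open>k\<close> vertices need a separate argument.\<close>

lemma ext_bound_le_power:
  assumes "4 \<le> k" "k \<le> w"
  shows "ext_bound k w \<le> 2 ^ (w - w div (k - 1))"
proof -
  obtain j where w: "w = k + j" using assms le_Suc_ex by blast
  obtain r where k: "k = Suc r" "3 \<le> r" using assms by (cases k) auto
  have "w div (k - 1) = (r + (j + 1)) div r" using w k by simp
  also have "\<dots> = 1 + (j + 1) div r" using k by (subst div_add_self1) auto
  also have "(j + 1) div r \<le> (j + 1) div 3" using k by (intro div_le_mono2) auto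
  finally have le: "w div (k - 1) \<le> 1 + (j + 1) div 3" by simp
  have "(j + 1) div 3 \<le> j" by simp
  have "ext_bound k w = 2 ^ (k - 3) * (j + 4)" using w assms by (simp add: ext_bound_def)
  also have "\<dots> \<le> 2 ^ (k - 3) * 2 ^ (j + 2 - (j + 1) div 3)" using add_4_le_power by simp
  also have "\<dots> = 2 ^ (k - 3 + (j + 2 - (j + 1) div 3))" by (rule power_add[symmetric])
  also have "\<dots> \<le> 2 ^ (w - w div (k - 1))"
  proof (rule power_increasing)
    show "k - 3 + (j + 2 - (j + 1) div 3) \<le> w - w div (k - 1)"
      using le w assms \<open>(j + 1) div 3 \<le> j\<close> by linarith
  qed simp
  finally show ?thesis .
qed

text \<open>Each added vertex multiplies the count by at most what the Turan graph gains, so a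
  comparison valid at \<open>m\<close> vertices persists; \<open>a\<close> and \<open>b\<close>
  carry a rational slack through the induction.\<close>

lemma free_complete_chain:
  assumes "4 \<le> k" "k \<le> m" "m \<le> w"
    and "\<And>W :: 'a set. card W = m \<Longrightarrow>
      a * card (free_orients k (complete_arcs W)) < b * 2 ^ turan_number (k - 1) m"
    and "card (W :: 'a set) = w"
  shows "a * card (free_orients k (complete_arcs W)) < b * 2 ^ turan_number (k - 1) w"
  using assms(3,5)
proof (induction w arbitrary: W rule: dec_induct)
  case base
  then show ?case using assms(4) by blast
next
  case (step w W')
  have "finite W'" using step.prems card.infinite by fastforce
  then obtain v W where W: "W' = insert v W" "v \<notin> W" "card W = w" "finite W"
    using step.prems by (metis card_Suc_eq finite_insert)
  have "a * card (free_orients k (complete_arcs W')) \<le>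
      a * card (free_orients k (complete_arcs W)) * ext_bound k w"
    using card_free_orients_complete_insert[OF W(4,2), of k] W assms(1) by simp
  also have "\<dots> \<le> a * card (free_orients k (complete_arcs W)) * 2 ^ (w - w div (k - 1))"
    using ext_bound_le_power[of k w] assms(1,2) step.hyps by (intro mult_left_mono) auto
  also have "\<dots> < b * 2 ^ turan_number (k - 1) w * 2 ^ (w - w div (k - 1))"
    using step.IH[OF W(3)] by simp
  also have "\<dots> = b * 2 ^ turan_number (k - 1) (Suc w)"
  proof -
    have "0 < k - 1" using assms(1) by simp
    then show ?thesis by (simp only: turan_number_Suc power_add mult.assoc)
  qed
  finally show ?case .
qed

text \<open>The coefficient of \<open>m\<close> is the exponent bounding
  \<open>ext_bound k (w - 1)\<close> for \<open>r = k - 1\<close>. The induction step comes down to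
  \<open>(w + m) div r \<le> m div r + (w - 1) div r + 1\<close>.\<close>

lemma turan_number_add_ge:
  assumes "0 < r" "0 < w"
  shows "turan_number r w + turan_number r m + m * (w - 1 - (w - 1) div r) \<le> turan_number r (w + m)"
proof (induction m)
  case (Suc m)
  have "(w + m) div r \<le> m div r + (w - 1) div r + 1"
  proof -
    have "w + m = (m div r + (w - 1) div r) * r + (m mod r + (w - 1) mod r + 1)"
      using assms div_mult_mod_eq[of m r] div_mult_mod_eq[of "w - 1" r]
      unfolding add_mult_distrib by linarith
    also have "\<dots> < (m div r + (w - 1) div r) * r + 2 * r"
      using mod_less_divisor[OF assms(1), of m] mod_less_divisor[OF assms(1), of "w - 1"] by linarith
    also have "\<dots> = (m div r + (w - 1) div r + 2) * r" by (simp add: algebra_simps)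
    finally have "(w + m) div r < m div r + (w - 1) div r + 2" by (rule less_mult_imp_div_less)
    then show ?thesis by simp
  qed
  moreover have "m div r \<le> m" "(w - 1) div r \<le> w - 1" by simp_all
  ultimately have "(m - m div r) + (w - 1 - (w - 1) div r) \<le> w + m - (w + m) div r"
    using assms(2) by linarith
  moreover have "turan_number r (w + Suc m) = turan_number r (w + m) + (w + m - (w + m) div r)"
    "turan_number r (Suc m) = turan_number r m + (m - m div r)"
    using turan_number_Suc[OF assms(1)] by simp_all
  moreover have "Suc m * (w - 1 - (w - 1) div r) = m * (w - 1 - (w - 1) div r) + (w - 1 - (w - 1) div r)"
    by simp
  ultimately show ?case using Suc.IH by linarith
qed simp

text \<open>Among the first \<open>Suc r\<close> vertices only \<open>0\<close> and \<open>r\<close>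
  share a class. A later vertex is joined to \<open>r\<close> of these vertices, or to
  \<open>r - 1\<close> if it lies in that class, which happens \<open>m div r\<close> times.\<close>

lemma turan_number_add_Suc:
  assumes "0 < r"
  shows "turan_number r (Suc r + m) + m div r = turan_number r (Suc r) + turan_number r m + m * r"
proof (induction m)
  case (Suc m)
  have "(Suc r + m) div r = Suc m div r + 1"
    using assms div_add_self1[of r "Suc m"] by simp
  moreover have "m div r \<le> m" "Suc m div r \<le> r + m"
    using assms div_le_dividend[of m r] div_le_dividend[of "Suc m" r] by linarith+
  moreover have "turan_number r (Suc r + Suc m) =
      turan_number r (Suc r + m) + (Suc r + m - (Suc r + m) div r)"
    "turan_number r (Suc m) = turan_number r m + (m - m div r)"
    using turan_number_Suc[OF assms] by simp_all
  moreover have "Suc m * r = m * r + r" by simp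
  ultimately show ?case using Suc.IH by linarith
qed simp

section \<open>Complete graphs against Turan graphs\<close>

lemma turan_number_numeral:
  "turan_number 3 (numeral n) =
    turan_number 3 (pred_numeral n) + (pred_numeral n - pred_numeral n div 3)"
  by (simp only: numeral_eq_Suc[of n] turan_number_Suc zero_less_numeral)

lemma turan_number_3:
  "turan_number 3 3 = 3" "turan_number 3 4 = 5" "turan_number 3 5 = 8" "turan_number 3 6 = 12"
  "turan_number 3 7 = 16" "turan_number 3 8 = 21" "turan_number 3 9 = 27"
  using turan_number_Suc[of 3 0] by (simp_all add: turan_number_numeral)

lemma turan_number_complete:
  assumes "n \<le> r" "0 < r"
  shows "turan_number r n = n * (n - 1) div 2"
  using assms(1)
proof (induction n)
  case (Suc n)
  have "Suc n * (Suc n - 1) div 2 = (n * (n - 1) + 2 * n) div 2" by (cases n) auto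
  also have "\<dots> = n * (n - 1) div 2 + n" by simp
  finally show ?case using Suc assms(2) by (simp add: turan_number_Suc)
qed simp

text \<open>The Turan graph on \<open>k\<close> vertices lacks exactly one edge of the complete
  graph, so at \<open>w = k\<close> the claim is that of
  \<open>free_complete_lt_half\<close>.\<close>

lemma free_complete_lt_turan:
  assumes "5 \<le> k" "k \<le> w" "card W = w"
  shows "card (free_orients k (complete_arcs W)) < 2 ^ turan_number (k - 1) w"
proof -
  have "1 * card (free_orients k (complete_arcs W)) < 1 * 2 ^ turan_number (k - 1) w"
  proof (rule free_complete_chain[where m = k])
    fix W :: "'a set" assume W: "card W = k"
    obtain r where k: "k = Suc r" using assms by (cases k) auto
    have "k * (k - 1) div 2 = Suc (turan_number (k - 1) k)"
    proof -
      have "Suc r * (Suc r - 1) div 2 = (r * (r - 1) + 2 * r) div 2" by (cases r) auto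
      also have "\<dots> = r * (r - 1) div 2 + r" by simp
      finally show ?thesis
        using k assms turan_number_complete[of r r] by (simp add: turan_number_Suc)
    qed
    then show "1 * card (free_orients k (complete_arcs W)) < 1 * 2 ^ turan_number (k - 1) k"
      using free_complete_lt_half[OF assms(1) W] by simp
  qed (use assms in auto)
  then show ?thesis by simp
qed

text \<open>The chain starts with \<open>240 < 2 ^ 8\<close> at five vertices; at four the
  inequality is false.\<close>

lemma four_free_complete_lt_turan:
  assumes "5 \<le> w" "card W = w"
  shows "card (free_orients 4 (complete_arcs W)) < 2 ^ turan_number 3 w"
proof -
  have "1 * card (free_orients 4 (complete_arcs W)) < 1 * 2 ^ turan_number (4 - 1) w"
    by (rule free_complete_chain[where m = 5])
      (use assms in \<open>auto simp: four_free_complete_5 turan_number_3\<close>)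
  then show ?thesis by simp
qed

text \<open>The slack absorbs the factor \<open>5 / 4\<close> by which \<open>K\<^sub>4\<close> exceeds the Turan graph.\<close>

lemma four_free_complete_lt_turan_slack:
  assumes "6 \<le> w" "card W = w"
  shows "5 * card (free_orients 4 (complete_arcs W)) < 4 * 2 ^ turan_number 3 w"
proof -
  have "5 * card (free_orients 4 (complete_arcs W)) < 4 * 2 ^ turan_number (4 - 1) w"
  proof (rule free_complete_chain[where m = 6])
    fix W' :: "'a set" assume W': "card W' = 6"
    have "finite W'" using W' card.infinite by fastforce
    then obtain v U where U: "W' = insert v U" "v \<notin> U" "card U = 5" "finite U"
      using W' by (metis card_Suc_eq finite_insert eval_nat_numeral(2,3) semiring_norm(26-28))
    \<comment> \<open>\<open>10 = ext_bound 4 5\<close>, and \<open>5 * 2400 < 4 * 2 ^ 12\<close>.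
      Five vertices do not have the slack: \<open>5 * 240 > 4 * 2 ^ 8\<close>.\<close>
    have "card (free_orients 4 (complete_arcs W')) \<le> 240 * 10"
      using card_free_orients_complete_insert[OF U(4,2), of 4] U
      by (simp add: four_free_complete_5 ext_bound_def)
    then show "5 * card (free_orients 4 (complete_arcs W')) < 4 * 2 ^ turan_number (4 - 1) 6"
      by (simp add: turan_number_3)
  qed (use assms in auto)
  then show ?thesis by simp
qed

text \<open>Three steps in \<open>m\<close> multiply the left side by \<open>54\<close> for
  \<open>r = 3\<close> and the right side by \<open>64\<close>. The ratio \<open>3 / 4\<close> is
  that of \<open>ext_bound k (k - 1)\<close> to \<open>2 ^ (k - 1)\<close>, and
  \<open>m div r\<close> is the deficit in \<open>turan_number_add_Suc\<close>.\<close>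

lemma power_div_le:
  assumes "3 \<le> r"
  shows "3 ^ m * 2 ^ (m div r) \<le> (4::nat) ^ m"
proof -
  have "3 ^ m * 2 ^ (m div 3) \<le> (4::nat) ^ m"
  proof (induction m rule: less_induct)
    case (less m)
    show ?case
    proof (cases "m < 3")
      case True
      then show ?thesis by (auto simp: power_mono)
    next
      case False
      then obtain i where i: "m = i + 3" by (metis add.commute le_Suc_ex not_less)
      have "3 ^ m * 2 ^ (m div 3) = 54 * (3 ^ i * 2 ^ (i div 3) :: nat)"
        using i by (simp add: power_add)
      also have "\<dots> \<le> 64 * 4 ^ i" using less[of i] i by simp
      also have "\<dots> = 4 ^ m" using i by (simp add: power_add)
      finally show ?thesis .
    qed
  qed
  moreover have "(2::nat) ^ (m div r) \<le> 2 ^ (m div 3)"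
    using assms by (intro power_increasing div_le_mono2) auto
  ultimately show ?thesis by (meson le_trans mult_le_mono2)
qed

text \<open>The factor \<open>5 / 4\<close> breaks the inequality at 0 (\<open>5 > 4\<close>) and at
  3 (\<open>270 > 256\<close>), so the residue class 0 modulo 3 starts afresh at 6.\<close>

lemma power_div_3_less:
  assumes "m \<noteq> 0" "m \<noteq> 3"
  shows "5 * (3 ^ m * 2 ^ (m div 3)) < 4 * (4::nat) ^ m"
  using assms
proof (induction m rule: less_induct)
  case (less m)
  consider "m = 1" | "m = 2" | "m = 6" | i where "m = i + 3" "i \<noteq> 0" "i \<noteq> 3"
  proof (cases "m < 3")
    case True
    then have "m = 1 \<or> m = 2" using less.prems by auto
    then show ?thesis using that by blast
  next
    case False
    then have "m = m - 3 + 3" by simp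
    then show ?thesis using that(3) that(4)[of "m - 3"] less.prems by force
  qed
  then show ?case
  proof cases
    case (4 i)
    have "5 * (3 ^ m * 2 ^ (m div 3)) = 54 * (5 * (3 ^ i * 2 ^ (i div 3)) :: nat)"
      using 4 by (simp add: power_add)
    also have "\<dots> < 64 * (4 * 4 ^ i)" using less.IH[of i] 4 by simp
    also have "\<dots> = 4 * 4 ^ m" using 4 by (simp add: power_add)
    finally show ?thesis .
  qed simp_all
qed

section \<open>Graphs containing a large clique\<close>

text \<open>Of the 8 tournaments on \<open>T\<close> two are strong; each of the other 6 has at most
  \<open>ext_bound 4 3 = 6\<close> extensions.\<close>

lemma card_four_free_not_strong_le:
  assumes W: "W = insert x T" "x \<notin> T" "card T = 3"
  shows "card {R \<in> free_orients 4 (complete_arcs W). \<not> strong_on R T} \<le> 36"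
proof -
  have fin: "finite T" using W(3) card.infinite by fastforce
  have r: "complete_arcs W \<inter> T \<times> T = complete_arcs T" "W - T = {x}"
      "complete_arcs W \<inter> {x} \<times> {x} = {}" "T \<inter> complete_arcs W `` {x} = T"
    using W by auto
  let ?N = "{R. R \<in> orients (complete_arcs T) \<and> \<not> strong_on R T}"
  have "card (orients (complete_arcs T)) = card (strong_tours T) + card ?N"
  proof -
    have "orients (complete_arcs T) = strong_tours T \<union> ?N" by (auto simp: strong_tours_def)
    then have "card (orients (complete_arcs T)) = card (strong_tours T \<union> ?N)" by (rule arg_cong)
    also have "\<dots> = card (strong_tours T) + card ?N"
      using fin finite_orients[of "complete_arcs T"]
      by (intro card_Un_disjoint) (auto simp: strong_tours_def)
    finally show ?thesis .
  qed
  moreover have "card (orients (complete_arcs T)) = 8"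
    using card_orients(1)[OF _ complete_arcs_simple, of T] fin W(3) by (simp add: card_complete_arcs)
  moreover have "card (strong_tours T) = 2"
  proof -
    have "T \<noteq> {}" using W(3) by auto
    then show ?thesis using card_strong_tours[of T] fin W(3) by (simp add: strong_number_def)
  qed
  ultimately have N: "card ?N = 6" by simp
  have O: "free_orients 4 (complete_arcs T) = orients (complete_arcs T)"
    using fin W by (intro free_orients_complete_small) auto
  have e: "card (extensions 4 (complete_arcs W) R x T) \<le> 6" if R: "R \<in> ?N" for R
  proof -
    have "card (extensions 4 (complete_arcs W) R x T) \<le> ext_bound 4 (card T)"
    proof (rule card_extensions_le[where W = T])
      show "R \<in> free_orients 4 (complete_arcs W \<inter> T \<times> T)" using R r(1) O by simp
      show "clique_in (complete_arcs W) T" using W by (intro clique_in_complete) auto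
    qed (use fin W in auto)
    then show ?thesis using W by (simp add: ext_bound_def)
  qed
  have q: "\<not> strong_on (R \<inter> T \<times> T) T \<longleftrightarrow> \<not> strong_on R T" for R
    using strong_on_cong[of T "R \<inter> T \<times> T" R] by auto
  have "card {R \<in> free_orients 4 (complete_arcs W). \<not> strong_on (R \<inter> T \<times> T) T} \<le>
      (\<Sum>R\<in>?N. card (extensions 4 (complete_arcs W) R x T)) * card (free_orients 4 ({} :: 'a rel))"
    using card_free_orients_restricted_le[of W "complete_arcs W" T 4 "\<lambda>R. \<not> strong_on R T"]
      fin W(1) complete_arcs_simple(1)[of W] r O by auto
  also have "\<dots> \<le> (card ?N * 6) * 1"
    using sum_bounded_above[of ?N, OF e] by (intro mult_le_mono card_free_orients_empty_le) simp
  finally show ?thesis using N unfolding q by simp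
qed

text \<open>
  The uniform estimate \<open>40 * 6 ^ 3 * 8\<close> exceeds \<open>2 ^ 16\<close>. It is improved by noting that a vertex
  joined to a strong triangle of \<open>W\<close> has only \<open>2\<close> extensions instead of \<open>6\<close>.
\<close>

lemma four_free_seven:
  assumes V: "finite V" "E \<subseteq> V \<times> V" "sym E" "irrefl E" "card V = 7"
    and W: "W \<subseteq> V" "clique_in E W" "card W = 4"
    and deg: "\<And>v. v \<in> V - W \<Longrightarrow> card (W \<inter> E `` {v}) \<le> 3"
    and rest: "card (free_orients 4 (E \<inter> (V - W) \<times> (V - W))) \<le> 8"
  shows "card (free_orients 4 E) < 2 ^ 16"
proof -
  have finW: "finite W" using W V finite_subset by blast
  have Z: "card (V - W) = 3" "finite (V - W)" using V W finW by (auto simp: card_Diff_subset)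
  show ?thesis
  proof (cases "\<exists>v\<in>V - W. card (W \<inter> E `` {v}) = 3")
    case False
    have "card (W \<inter> E `` {v}) \<le> 2" if "v \<in> V - W" for v
    proof -
      have "card (W \<inter> E `` {v}) \<noteq> 3" using False that by blast
      then show ?thesis using deg[OF that] by simp
    qed
    then have "card (free_orients 4 E) \<le> card (free_orients 4 (complete_arcs W)) *
        ext_bound 4 2 ^ card (V - W) * card (free_orients 4 (E \<inter> (V - W) \<times> (V - W)))"
      using V W by (intro card_free_orients_clique_le) auto
    also have "\<dots> \<le> 40 * 4 ^ 3 * 8"
      using rest Z four_free_complete_4[OF W(3)] by (simp add: ext_bound_def)
    finally show ?thesis by simp
  next
    case True
    then obtain v where v: "v \<in> V - W" "card (W \<inter> E `` {v}) = 3" by blast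
    define T where "T = W \<inter> E `` {v}"
    have "card (W - T) = 1" using W finW v(2) by (simp add: T_def card_Diff_subset)
    then obtain x where "W - T = {x}" by (rule card_1_singletonE)
    then have T: "W = insert x T" "x \<notin> T" "card T = 3" using v(2) by (auto simp: T_def)
    let ?F = "free_orients 4 (complete_arcs W)"
    let ?e = "\<lambda>R u. card (extensions 4 E R u (W \<inter> E `` {u}))"
    have EW: "E \<inter> W \<times> W = complete_arcs W"
      using W V(4) unfolding clique_in_def irrefl_def by auto
    have e6: "?e R u \<le> 6" if R: "R \<in> ?F" and u: "u \<in> V - W" for R u
    proof -
      have "?e R u \<le> ext_bound 4 (card (W \<inter> E `` {u}))"
      proof (rule card_extensions_le[where W = W])
        show "R \<in> free_orients 4 (E \<inter> W \<times> W)" using R EW by simp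
        show "clique_in E (W \<inter> E `` {u})" using W(2) clique_in_subset by blast
      qed (use u finW in auto)
      also have "\<dots> \<le> ext_bound 4 3" using deg[OF u] ext_bound_mono[of _ 3 4] by simp
      finally show ?thesis by (simp add: ext_bound_def)
    qed
    have ev: "?e R v \<le> 2 + (if strong_on R T then 0 else 4)" if R: "R \<in> ?F" for R
    proof (cases "strong_on R T")
      case True
      have "?e R v \<le> 2"
      proof (rule card_extensions_strong[where W = W])
        show "R \<subseteq> W \<times> W" using R by (auto simp: free_orients_def orients_def)
        show "clique_in E (W \<inter> E `` {v})" using W(2) clique_in_subset by blast
      qed (use v True in \<open>auto simp: T_def\<close>)
      then show ?thesis by simp
    qed (use e6[OF R v(1)] in simp)
    have finF: "finite ?F" using finW by (intro finite_free_orients) auto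
    have "(\<Prod>u\<in>V - W. ?e R u) \<le> (2 + (if strong_on R T then 0 else 4)) * 36" if R: "R \<in> ?F" for R
    proof -
      have "(\<Prod>u\<in>V - W - {v}. ?e R u) \<le> (\<Prod>u\<in>V - W - {v}. 6)"
        using e6[OF R] by (intro prod_mono) auto
      also have "\<dots> = 36" using Z v by simp
      finally have others: "(\<Prod>u\<in>V - W - {v}. ?e R u) \<le> 36" .
      have "(\<Prod>u\<in>V - W. ?e R u) = ?e R v * (\<Prod>u\<in>V - W - {v}. ?e R u)"
        using Z v by (intro prod.remove) auto
      also have "\<dots> \<le> (2 + (if strong_on R T then 0 else 4)) * 36"
        by (rule mult_le_mono[OF ev[OF R] others])
      finally show ?thesis .
    qed
    then have "(\<Sum>R\<in>?F. \<Prod>u\<in>V - W. ?e R u) \<le>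
        (\<Sum>R\<in>?F. (2 + (if strong_on R T then 0 else 4)) * 36)"
      by (rule sum_mono)
    also have "\<dots> = (2 * card ?F + 4 * card {R \<in> ?F. \<not> strong_on R T}) * 36"
      using finF by (simp add: sum_distrib_right[symmetric] sum.distrib sum.If_cases Int_def Collect_neg_eq[symmetric] conj_commute)
    \<comment> \<open>The last factor is \<open>6 * 6\<close> for the other two outside vertices. In
      total \<open>224 * 36 * 8 = 64512\<close>, just below \<open>2 ^ 16 = 65536\<close>.\<close>
    also have "\<dots> \<le> (2 * 40 + 4 * 36) * 36"
      using card_four_free_not_strong_le[OF T] four_free_complete_4[OF W(3)] by simp
    finally have "(\<Sum>R\<in>?F. \<Prod>u\<in>V - W. ?e R u) *
        card (free_orients 4 (E \<inter> (V - W) \<times> (V - W))) \<le> 224 * 36 * 8"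
      using rest by (intro mult_le_mono) auto
    then have "card (free_orients 4 E) \<le> 224 * 36 * 8"
      using card_free_orients_le[OF V(1-3) W(1), of 4] unfolding EW by simp
    then show ?thesis by simp
  qed
qed

text \<open>The claimed maximum, also for \<open>n < k\<close>, since the part of the graph outside
  the clique may be that small.\<close>

definition free_bound :: "nat \<Rightarrow> nat \<Rightarrow> nat" where
  "free_bound k n = (if n = 4 \<and> k = 4 then 40 else 2 ^ turan_number (k - 1) n)"

text \<open>Each factor is at most its Turan counterpart, the first one strictly. Only a rest of
  four vertices with \<open>k = 4\<close> may exceed it, by \<open>5 / 4\<close>: the slack for
  \<open>w \<ge> 6\<close> absorbs this, and \<open>w = 5\<close> is the direct check
  \<open>240 * 8 ^ 4 * 40 < 2 ^ 27\<close>.\<close>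

lemma large_clique_lt_turan:
  fixes W :: "'a set"
  assumes k: "4 \<le> k" "k < w" and W: "card W = w" and rest: "f \<le> free_bound k m"
  shows "card (free_orients k (complete_arcs W)) * ext_bound k (w - 1) ^ m * f
    < 2 ^ turan_number (k - 1) (w + m)"
proof -
  let ?t = "turan_number (k - 1)" and ?S = "card (free_orients k (complete_arcs W))"
  define \<delta> where "\<delta> = w - 1 - (w - 1) div (k - 1)"
  have "ext_bound k (w - 1) \<le> 2 ^ \<delta>"
    unfolding \<delta>_def using k by (intro ext_bound_le_power) auto
  then have X: "ext_bound k (w - 1) ^ m \<le> 2 ^ (m * \<delta>)"
    by (metis mult.commute power_mono power_mult zero_le)
  have t: "2 ^ (?t w + ?t m + m * \<delta>) \<le> (2::nat) ^ ?t (w + m)"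
    using turan_number_add_ge[of "k - 1" w m] k unfolding \<delta>_def by (intro power_increasing) auto
  show ?thesis
  proof (cases "m = 4 \<and> k = 4")
    case False
    then have f: "f \<le> 2 ^ ?t m" using rest by (simp add: free_bound_def split: if_splits)
    have S: "?S < 2 ^ ?t w"
    proof (cases "k = 4")
      case True
      then show ?thesis using four_free_complete_lt_turan[of w W] k W by simp
    next
      case False
      then show ?thesis using free_complete_lt_turan[of k w W] k W by simp
    qed
    have "?S * ext_bound k (w - 1) ^ m * f \<le> ?S * 2 ^ (m * \<delta>) * 2 ^ ?t m"
      using X f by (intro mult_le_mono) auto
    also have "\<dots> < 2 ^ ?t w * 2 ^ (m * \<delta>) * 2 ^ ?t m" using S by simp
    also have "\<dots> = 2 ^ (?t w + ?t m + m * \<delta>)" by (simp add: power_add)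
    also note t
    finally show ?thesis .
  next
    case True
    then have f: "f \<le> 40" and m: "m = 4" "k = 4" using rest by (auto simp: free_bound_def)
    show ?thesis
    proof (cases "w = 5")
      case True
      have "?S * ext_bound k (w - 1) ^ m * f \<le> 240 * 8 ^ 4 * 40"
        using f m True W by (intro mult_le_mono) (auto simp: four_free_complete_5 ext_bound_def)
      also have "\<dots> < 2 ^ 27" by simp
      finally show ?thesis using m True by (simp add: turan_number_3)
    next
      case False
      have S: "5 * ?S < 4 * 2 ^ ?t w"
        using four_free_complete_lt_turan_slack[of w W] k W m False by simp
      have "?S * ext_bound k (w - 1) ^ m * f \<le> ?S * 2 ^ (m * \<delta>) * 40"
        using X f by (intro mult_le_mono) auto
      also have "\<dots> = 5 * ?S * (8 * 2 ^ (m * \<delta>))" by simp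
      also have "\<dots> < 4 * 2 ^ ?t w * (8 * 2 ^ (m * \<delta>))" using S by (intro mult_strict_right_mono) auto
      also have "\<dots> = 2 ^ (?t w + ?t m + m * \<delta>)"
        using m by (simp add: power_add turan_number_3)
      also note t
      finally show ?thesis .
    qed
  qed
qed

lemma small_clique_lt_turan:
  assumes k: "5 \<le> k" and W: "card W = k" and rest: "f \<le> free_bound k m"
  shows "card (free_orients k (complete_arcs W)) * ext_bound k (k - 1) ^ m * f
    < 2 ^ turan_number (k - 1) (k + m)"
proof -
  let ?t = "turan_number (k - 1)" and ?S = "card (free_orients k (complete_arcs W))"
  obtain r where r: "k = Suc r" "4 \<le> r" using k by (cases k) auto
  have f: "f \<le> 2 ^ ?t m" using rest k by (simp add: free_bound_def)
  have X: "ext_bound k (k - 1) = 3 * 2 ^ (k - 3)" using k by (simp add: ext_bound_def)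
  \<comment> \<open>The extra factor clears the deficit \<open>m div r\<close>, so that the Turan
    side becomes an exact product of powers of 2.\<close>
  have "?S * ext_bound k (k - 1) ^ m * f * 2 ^ (m div r) \<le>
      ?S * (3 * 2 ^ (k - 3)) ^ m * 2 ^ ?t m * 2 ^ (m div r)"
    using f unfolding X by (intro mult_le_mono) auto
  also have "\<dots> = ?S * (3 ^ m * 2 ^ (m div r)) * (2 ^ (k - 3)) ^ m * 2 ^ ?t m"
    by (simp add: power_mult_distrib)
  also have "\<dots> \<le> ?S * 4 ^ m * (2 ^ (k - 3)) ^ m * 2 ^ ?t m"
    using power_div_le[of r m] r by (intro mult_le_mono) auto
  also have "\<dots> < 2 ^ ?t k * 4 ^ m * (2 ^ (k - 3)) ^ m * 2 ^ ?t m"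
    using free_complete_lt_turan[OF k _ W] by simp
  also have "\<dots> = 2 ^ ?t k * (4 * 2 ^ (k - 3)) ^ m * 2 ^ ?t m"
    by (simp add: power_mult_distrib)
  also have "4 * 2 ^ (k - 3) = (2::nat) ^ r"
  proof -
    have "r = 2 + (k - 3)" using r by simp
    then have "(2::nat) ^ r = 2 ^ (2 + (k - 3))" by (rule arg_cong)
    then show ?thesis unfolding power_add by simp
  qed
  also have "2 ^ ?t k * (2 ^ r) ^ m * 2 ^ ?t m = (2::nat) ^ (?t k + ?t m + m * r)"
    by (simp add: power_add power_mult[symmetric] mult.commute)
  also have "\<dots> = 2 ^ (?t (k + m) + m div r)"
    using turan_number_add_Suc[of r m] r by simp
  also have "\<dots> = 2 ^ ?t (k + m) * 2 ^ (m div r)" by (rule power_add)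
  finally show ?thesis by simp
qed

text \<open>As for larger \<open>k\<close>, but with the initial surplus
  \<open>40 / 2 ^ 5 = 5 / 4\<close>. At \<open>m = 4\<close> the rest may reach 40 too, and
  \<open>40 * 6 ^ 4 * 40 < 2 ^ 21\<close> still holds narrowly. The case \<open>m = 0\<close> is
  \<open>K\<^sub>4\<close> itself, and \<open>m = 3\<close> is
  \<open>four_free_seven\<close>.\<close>

lemma four_clique_lt_turan:
  assumes W: "card W = 4" and rest: "f \<le> free_bound 4 m" and m: "m \<noteq> 0" "m \<noteq> 3"
  shows "card (free_orients 4 (complete_arcs W)) * ext_bound 4 3 ^ m * f < 2 ^ turan_number 3 (4 + m)"
proof (cases "m = 4")
  case True
  then show ?thesis using W rest
    by (simp add: four_free_complete_4 ext_bound_def free_bound_def turan_number_3)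
next
  case False
  let ?t = "turan_number 3"
  have f: "f \<le> 2 ^ ?t m" using rest False by (simp add: free_bound_def)
  have "card (free_orients 4 (complete_arcs W)) * ext_bound 4 3 ^ m * f * 2 ^ (m div 3) \<le>
      40 * 6 ^ m * 2 ^ ?t m * 2 ^ (m div 3)"
    using f W by (intro mult_le_mono) (auto simp: four_free_complete_4 ext_bound_def)
  also have "\<dots> = 5 * (3 ^ m * 2 ^ (m div 3)) * (8 * 2 ^ m * 2 ^ ?t m)"
    using power_mult_distrib[of 3 "2::nat" m] by simp
  also have "\<dots> < 4 * 4 ^ m * (8 * 2 ^ m * 2 ^ ?t m)"
    using power_div_3_less[OF m] by (intro mult_strict_right_mono) auto
  also have "\<dots> = 2 ^ 5 * 2 ^ ?t m * 8 ^ m"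
    using power_mult_distrib[of 4 "2::nat" m] by simp
  also have "\<dots> = 2 ^ (?t 4 + ?t m + m * 3)"
    using power_mult[of "2::nat" 3 m] by (simp add: power_add turan_number_3 mult.commute)
  also have "\<dots> = 2 ^ (?t (4 + m) + m div 3)" using turan_number_add_Suc[of 3 m] by simp
  also have "\<dots> = 2 ^ ?t (4 + m) * 2 ^ (m div 3)" by (rule power_add)
  finally show ?thesis by simp
qed

lemma clique_free_free_orients:
  assumes V: "finite V" "E \<subseteq> V \<times> V" "sym E" "irrefl E" and k: "4 \<le> k"
    and none: "\<And>W. W \<subseteq> V \<Longrightarrow> clique_in E W \<Longrightarrow> card W \<noteq> k"
  shows "card (free_orients k E) = 2 ^ (card E div 2)"
    and "card E \<le> 2 * turan_number (k - 1) (card V)" and "even (card E)"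
proof -
  have "E \<inter> V \<times> V = E" "finite E" using V finite_subset[OF V(2)] by auto
  then have "card W \<noteq> k" if "clique_in E W" for W
    using none[OF _ that] clique_in_restrict(1)[of E V W] that k by fastforce
  then have "free_orients k E = orients E" by (rule free_orients_eq_orients)
  then show "card (free_orients k E) = 2 ^ (card E div 2)" "even (card E)"
    using card_orients[OF \<open>finite E\<close> V(3,4)] by auto
  show "card E \<le> 2 * turan_number (k - 1) (card V)"
    using V none k by (intro turan(1)) auto
qed

text \<open>The first conjunct is the induction hypothesis applied to \<open>V - W\<close>, which
  may be an exceptional \<open>K\<^sub>4\<close>; the strict second conjunct excludes
  \<open>k\<close>-cliques from extremal graphs.\<close>

lemma card_free_orients_bound:
  assumes "4 \<le> k" "finite V" "E \<subseteq> V \<times> V" "sym E" "irrefl E"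
  shows "card (free_orients k E) \<le> free_bound k (card V) \<and>
    ((\<exists>W\<subseteq>V. clique_in E W \<and> card W = k) \<longrightarrow> \<not> (card V = 4 \<and> k = 4) \<longrightarrow>
      card (free_orients k E) < 2 ^ turan_number (k - 1) (card V))"
  using assms(2-5)
proof (induction "card V" arbitrary: V E rule: less_induct)
  case less
  note V = less.prems and k = assms(1)
  show ?case
  proof (cases "\<exists>W\<subseteq>V. clique_in E W \<and> card W = k")
    case False
    note cf = clique_free_free_orients[OF V k]
    have "card (free_orients k E) = 2 ^ (card E div 2)" using cf(1) False by blast
    also have "\<dots> \<le> 2 ^ turan_number (k - 1) (card V)"
      using cf(2) False by (intro power_increasing) fastforce+
    also have "\<dots> \<le> free_bound k (card V)" by (simp add: free_bound_def turan_number_3)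
    finally show ?thesis using False by blast
  next
    case True
    then obtain W0 where W0: "W0 \<subseteq> V" "clique_in E W0" "card W0 = k" by blast
    let ?C = "{W. W \<subseteq> V \<and> clique_in E W}"
    have "finite ?C" by (rule finite_subset[of _ "Pow V"]) (use V in auto)
    then have fc: "finite (card ` ?C)" by simp
    have "W0 \<in> ?C" using W0 by blast
    then have "Max (card ` ?C) \<in> card ` ?C" by (intro Max_in[OF fc]) blast
    then obtain W where W: "W \<subseteq> V" "clique_in E W" "card W = Max (card ` ?C)" by auto
    have max: "card U \<le> card W" if "U \<subseteq> V" "clique_in E U" for U
      using that fc unfolding W(3) by (intro Max_ge) auto
    have kW: "k \<le> card W" using max[of W0] W0 by simp
    have finW: "finite W" using W V finite_subset by blast
    define w where "w = card W"
    define m where "m = card (V - W)"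
    have n: "card V = w + m"
      unfolding w_def m_def using card_Diff_subset[OF finW W(1)] card_mono[OF V(1) W(1)] by linarith
    have EW: "E \<inter> W \<times> W = complete_arcs W"
      using W V(4) unfolding clique_in_def irrefl_def by auto
    have deg: "card (W \<inter> E `` {v}) \<le> w - 1" if v: "v \<in> V - W" for v
    proof -
      have "W \<inter> E `` {v} \<noteq> W"
      proof
        assume eq: "W \<inter> E `` {v} = W"
        then have "clique_in E (insert v W)"
          using W(2) V(3) unfolding clique_in_def by (blast dest: symD)
        then show False using max[of "insert v W"] v W(1) finW by auto
      qed
      then have "card (W \<inter> E `` {v}) < card W" using finW by (intro psubset_card_mono) auto
      then show ?thesis by (simp add: w_def)
    qed
    define f where "f = card (free_orients k (E \<inter> (V - W) \<times> (V - W)))"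
    have "card (V - W) < card V" using kW k n by (simp add: w_def m_def)
    then have f: "f \<le> free_bound k m"
      unfolding f_def m_def using V by (intro less.hyps[THEN conjunct1])
        (auto simp: sym_def irrefl_def)
    have le: "card (free_orients k E) \<le>
        card (free_orients k (complete_arcs W)) * ext_bound k (w - 1) ^ m * f"
      unfolding f_def m_def using V W k deg by (intro card_free_orients_clique_le) auto
    have strict: "card (free_orients k E) < 2 ^ turan_number (k - 1) (card V)"
      if ne: "\<not> (card V = 4 \<and> k = 4)"
    proof -
      have "k < w \<or> k = w \<and> 5 \<le> k \<or> k = w \<and> k = 4 \<and> m \<noteq> 0"
        using kW k ne n unfolding w_def by auto
      then consider "k < w" | "k = w" "5 \<le> k" | "k = w" "k = 4" "m \<noteq> 0" "m \<noteq> 3"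
        | "k = w" "k = 4" "m = 3"
        by blast
      then show ?thesis
      proof cases
        case 1
        then show ?thesis
          using le large_clique_lt_turan[OF k 1 _ f, of W] n by (simp add: w_def)
      next
        case 2
        then show ?thesis
          using le small_clique_lt_turan[OF 2(2) _ f, of W] n by (simp add: w_def)
      next
        case 3
        then show ?thesis
          using le four_clique_lt_turan[of W f m] f n by (simp add: w_def)
      next
        case 4
        then have "f \<le> 8" using f by (simp add: free_bound_def turan_number_3)
        then have "card (free_orients 4 E) < 2 ^ 16"
          using V W n 4 deg unfolding f_def
          by (intro four_free_seven[of V E W]) (auto simp: w_def)
        then show ?thesis using n 4 by (simp add: turan_number_3)
      qed
    qed
    show ?thesis
    proof (cases "card V = 4 \<and> k = 4")
      case True
      then have "V = W" using kW W V by (metis card_seteq)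
      then have "E = complete_arcs V" using EW V(2) by auto
      then show ?thesis using True four_free_complete_4[of V] by (simp add: free_bound_def)
    next
      case False
      then have "free_bound k (card V) = 2 ^ turan_number (k - 1) (card V)"
        unfolding free_bound_def by (rule if_not_P)
      then show ?thesis using strict[OF False] by simp
    qed
  qed
qed

section \<open>Pair digraphs and isomorphism\<close>

text \<open>A closed set contains everything reachable from it, and the set reachable from a vertex
  is closed.\<close>

lemma strongly_connected_pair_iff:
  assumes "W \<noteq> {}" "R \<subseteq> W \<times> W"
  shows "strongly_connected (with_proj \<lparr>pverts = W, parcs = R\<rparr>) \<longleftrightarrow> strong_on R W"
proof
  assume sc: "strongly_connected (with_proj \<lparr>pverts = W, parcs = R\<rparr>)"
  show "strong_on R W"
  proof (rule strong_onI)
    fix A assume A: "A \<subseteq> W" "A \<noteq> {}" "\<And>a b. a \<in> A \<Longrightarrow> b \<in> W \<Longrightarrow> (a, b) \<in> R \<Longrightarrow> b \<in> A"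
    then obtain a where a: "a \<in> A" by blast
    show "W \<subseteq> A"
    proof
      fix w assume "w \<in> W"
      then have "(a, w) \<in> rtrancl_on W R"
        using sc a A(1) by (auto simp: strongly_connected_def reachable_def)
      from this a show "w \<in> A" by (induction rule: rtrancl_on.induct) (use A(3) in blast)+
    qed
  qed
next
  assume strong: "strong_on R W"
  have "(u, v) \<in> rtrancl_on W R" if "u \<in> W" "v \<in> W" for u v
  proof -
    have "{x \<in> W. (u, x) \<in> rtrancl_on W R} = W"
      by (rule strong_onD[OF strong]) (use that in \<open>auto intro: rtrancl_on_into_rtrancl_on\<close>)
    then show ?thesis using that by blast
  qed
  then show "strongly_connected (with_proj \<lparr>pverts = W, parcs = R\<rparr>)"
    using assms(1) by (simp add: strongly_connected_def reachable_def)
qed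

lemma with_proj_induce:
  "with_proj G \<restriction> W = with_proj \<lparr>pverts = W, parcs = parcs G \<inter> W \<times> W\<rparr>"
  by (auto simp: induce_subgraph_def with_proj_def)

lemma pair_graph_arcs_simple:
  assumes "pair_graph G"
  shows "finite (pverts G)" "parcs G \<subseteq> pverts G \<times> pverts G" "sym (parcs G)" "irrefl (parcs G)"
proof -
  interpret pair_graph G by fact
  show "finite (pverts G)" by (rule pair_finite_verts)
  show "parcs G \<subseteq> pverts G \<times> pverts G" using in_arcsD1 in_arcsD2 by auto
  show "sym (parcs G)" using arcs_symmetric by (auto intro: symI)
  show "irrefl (parcs G)" using no_loops' by (auto simp: irrefl_def)
qed

lemma complete_digraph_induce_iff:
  assumes "pair_graph G" "card W = k" "0 < k"
  shows "complete_digraph k (with_proj G \<restriction> W) \<longleftrightarrow> clique_in (parcs G) W"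
proof -
  have "finite W" using assms(2,3) card_ge_0_finite by blast
  then have "complete_digraph k (with_proj G \<restriction> W) \<longleftrightarrow>
      parcs G \<inter> W \<times> W = {(u, v). (u, v) \<in> W \<times> W \<and> u \<noteq> v}"
    using assms(2) by (simp add: with_proj_induce complete_digraph_pair_def)
  also have "\<dots> \<longleftrightarrow> clique_in (parcs G) W"
    using pair_graph_arcs_simple(4)[OF assms(1)] unfolding clique_in_def irrefl_def by auto
  finally show ?thesis .
qed

lemma strong_tournament_free_iff:
  assumes G: "pair_graph G" and "2 \<le> k"
  shows "strong_tournament_free k G D \<longleftrightarrow>
    (\<forall>W. card W = k \<longrightarrow> clique_in (parcs G) W \<longrightarrow> \<not> strong_on (parcs D) W)"
proof -
  have "W \<subseteq> pverts G \<and> card W = k \<and> complete_digraph k (with_proj G \<restriction> W) \<and>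
      strongly_connected (with_proj D \<restriction> W) \<longleftrightarrow>
      card W = k \<and> clique_in (parcs G) W \<and> strong_on (parcs D) W" for W
  proof (cases "card W = k")
    case True
    have "W \<subseteq> pverts G" if "clique_in (parcs G) W"
      using clique_in_restrict(1)[of "parcs G" "pverts G" W] pair_graph_arcs_simple(2)[OF G] that
        True assms(2) by (simp add: Int_absorb2)
    moreover have "W \<noteq> {}" using True assms(2) by auto
    then have "strongly_connected (with_proj D \<restriction> W) \<longleftrightarrow> strong_on (parcs D \<inter> W \<times> W) W"
      unfolding with_proj_induce by (intro strongly_connected_pair_iff) auto
    moreover have "strong_on (parcs D \<inter> W \<times> W) W \<longleftrightarrow> strong_on (parcs D) W"
      by (intro strong_on_cong) auto
    ultimately show ?thesis
      using complete_digraph_induce_iff[OF G True] True assms(2) by auto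
  qed simp
  then show ?thesis unfolding strong_tournament_free_def by blast
qed

lemma S_graph_eq:
  assumes G: "pair_graph G" and "2 \<le> k"
  shows "S_graph k G = card (free_orients k (parcs G))"
proof -
  have ori: "orientation D G \<longleftrightarrow> pverts D = pverts G \<and> parcs D \<in> orients (parcs G)" for D
    by (auto simp: orientation_def orients_def)
  have "bij_betw parcs {D. orientation D G \<and> strong_tournament_free k G D} (free_orients k (parcs G))"
  proof (rule bij_betwI[where g = "\<lambda>R. \<lparr>pverts = pverts G, parcs = R\<rparr>"])
    show "(\<lambda>R. \<lparr>pverts = pverts G, parcs = R\<rparr>) \<in> free_orients k (parcs G) \<rightarrow>
        {D. orientation D G \<and> strong_tournament_free k G D}"
      by (auto simp: ori strong_tournament_free_iff[OF assms] free_orients_def)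
  qed (auto simp: ori strong_tournament_free_iff[OF assms] free_orients_def)
  then show ?thesis unfolding S_graph_def by (rule bij_betw_same_card)
qed

lemma digraph_iso_pair_iff:
  assumes "pair_graph G" "pair_graph H"
  shows "digraph_iso (with_proj G) (with_proj H) \<longleftrightarrow>
    (\<exists>f. bij_betw f (pverts G) (pverts H) \<and>
      (\<forall>u\<in>pverts G. \<forall>v\<in>pverts G. (u, v) \<in> parcs G \<longleftrightarrow> (f u, f v) \<in> parcs H))"
proof -
  interpret G: pair_graph G by fact
  interpret H: pair_graph H by fact
  show ?thesis
  proof
    assume "digraph_iso (with_proj G) (with_proj H)"
    then obtain h where h: "G.digraph_isomorphism h" "with_proj H = app_iso h (with_proj G)"
      unfolding digraph_iso_def by blast
    let ?f = "iso_verts h"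
    have inj: "inj_on ?f (pverts G)" using h(1) by (auto simp: G.digraph_isomorphism_def)
    have verts: "pverts H = ?f ` pverts G" using arg_cong[OF h(2), of verts] by simp
    have img: "parcs H = (\<lambda>(u, v). (?f u, ?f v)) ` parcs G"
      using arg_cong[OF h(2), of arcs_ends] G.arcs_ends_app_iso_eq[OF h(1)] by simp
    have arcs: "(u, v) \<in> parcs G \<longleftrightarrow> (?f u, ?f v) \<in> parcs H"
      if uv: "u \<in> pverts G" "v \<in> pverts G" for u v
    proof
      assume "(u, v) \<in> parcs G"
      then show "(?f u, ?f v) \<in> parcs H" unfolding img by (rule rev_image_eqI) simp
    next
      assume "(?f u, ?f v) \<in> parcs H"
      then obtain a b where ab: "(a, b) \<in> parcs G" "?f u = ?f a" "?f v = ?f b"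
        unfolding img by auto
      then have "u = a" "v = b"
        using uv inj_onD[OF inj] G.in_arcsD1[OF ab(1)] G.in_arcsD2[OF ab(1)] by blast+
      then show "(u, v) \<in> parcs G" using ab(1) by simp
    qed
    then show "\<exists>f. bij_betw f (pverts G) (pverts H) \<and>
      (\<forall>u\<in>pverts G. \<forall>v\<in>pverts G. (u, v) \<in> parcs G \<longleftrightarrow> (f u, f v) \<in> parcs H)"
      using inj verts arcs by (intro exI[of _ ?f]) (simp add: bij_betw_def)
  next
    assume "\<exists>f. bij_betw f (pverts G) (pverts H) \<and>
      (\<forall>u\<in>pverts G. \<forall>v\<in>pverts G. (u, v) \<in> parcs G \<longleftrightarrow> (f u, f v) \<in> parcs H)"
    then obtain f where f: "inj_on f (pverts G)" "f ` pverts G = pverts H"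
        "\<And>u v. u \<in> pverts G \<Longrightarrow> v \<in> pverts G \<Longrightarrow> (u, v) \<in> parcs G \<longleftrightarrow> (f u, f v) \<in> parcs H"
      by (auto simp: bij_betw_def)
    \<comment> \<open>The new head and tail maps are again the projections, so that the image is a
      pair digraph and can equal \<open>with_proj H\<close>.\<close>
    define h where "h = \<lparr>iso_verts = f, iso_arcs = map_prod f f, iso_head = snd, iso_tail = fst\<rparr>"
    have "inj_on (map_prod f f) (parcs G)"
      using f(1) G.in_arcsD1 G.in_arcsD2 by (auto simp: inj_on_def)
    then have "G.digraph_isomorphism h"
      using f(1) G.wf_digraph_axioms by (auto simp: G.digraph_isomorphism_def h_def)
    moreover have "parcs H = map_prod f f ` parcs G"
    proof (intro equalityI subrelI)
      fix x y assume xy: "(x, y) \<in> parcs H"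
      have "x \<in> f ` pverts G" "y \<in> f ` pverts G"
        using H.in_arcsD1[OF xy] H.in_arcsD2[OF xy] f(2) by simp_all
      then obtain u v where uv: "x = f u" "y = f v" "u \<in> pverts G" "v \<in> pverts G" by blast
      then have "(u, v) \<in> parcs G" using xy f(3) by simp
      then show "(x, y) \<in> map_prod f f ` parcs G" by (rule rev_image_eqI) (simp add: uv)
    next
      fix x y assume "(x, y) \<in> map_prod f f ` parcs G"
      then obtain u v where uv: "(u, v) \<in> parcs G" "x = f u" "y = f v" by auto
      then show "(x, y) \<in> parcs H"
        using f(3)[OF G.in_arcsD1[OF uv(1)] G.in_arcsD2[OF uv(1)]] by simp
    qed
    then have "with_proj H = app_iso h (with_proj G)"
      using f(2) by (simp add: app_iso_def h_def with_proj_def)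
    ultimately show "digraph_iso (with_proj G) (with_proj H)"
      unfolding digraph_iso_def by blast
  qed
qed

text \<open>Vertices of a clique lie in distinct residue classes, of which there are
  \<open>k - 1\<close>; hence there is no \<open>k\<close>-clique and every orientation
  counts.\<close>

lemma free_orients_turan:
  assumes V: "finite V" "E \<subseteq> V \<times> V" "sym E" "irrefl E" and k: "4 \<le> k"
    and f: "bij_betw f V {..<card V}"
    and E: "\<And>u v. u \<in> V \<Longrightarrow> v \<in> V \<Longrightarrow> (u, v) \<in> E \<longleftrightarrow> f u mod (k - 1) \<noteq> f v mod (k - 1)"
  shows "card (free_orients k E) = 2 ^ turan_number (k - 1) (card V)"
proof -
  have "card W \<noteq> k" if W: "W \<subseteq> V" "clique_in E W" for W
  proof -
    have "inj_on (\<lambda>u. f u mod (k - 1)) W"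
    proof (rule inj_onI, rule ccontr)
      fix u v assume "u \<in> W" "v \<in> W" "f u mod (k - 1) = f v mod (k - 1)" "u \<noteq> v"
      then show False using W E unfolding clique_in_def by blast
    qed
    then have "card W \<le> card {..<k - 1}" using k by (intro card_inj_on_le) auto
    then show ?thesis using k by simp
  qed
  then have "card (free_orients k E) = 2 ^ (card E div 2)"
    using clique_free_free_orients(1)[OF V k] by blast
  also have "card E = card (parcs (turan_graph (k - 1) (card V)))"
  proof (rule bij_betw_same_card)
    show "bij_betw (map_prod f f) E (parcs (turan_graph (k - 1) (card V)))"
    proof (rule bij_betw_imageI)
      show "inj_on (map_prod f f) E"
        using inj_on_subset[OF map_prod_inj_on V(2)] f unfolding bij_betw_def by blast
      show "map_prod f f ` E = parcs (turan_graph (k - 1) (card V))"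
      proof (intro equalityI subrelI)
        fix x y assume "(x, y) \<in> map_prod f f ` E"
        then obtain u v where "(u, v) \<in> E" "x = f u" "y = f v" by auto
        moreover have "u \<in> V" "v \<in> V" using calculation V(2) by auto
        ultimately show "(x, y) \<in> parcs (turan_graph (k - 1) (card V))"
          using E bij_betwE[OF f] by (auto simp: turan_graph_def)
      next
        fix x y assume xy: "(x, y) \<in> parcs (turan_graph (k - 1) (card V))"
        then have "x \<in> {..<card V}" "y \<in> {..<card V}" by (auto simp: turan_graph_def)
        then obtain u v where uv: "u \<in> V" "v \<in> V" "x = f u" "y = f v"
          using f unfolding bij_betw_def by (metis imageE)
        then have "(u, v) \<in> E" using xy E by (simp add: turan_graph_def)
        then show "(x, y) \<in> map_prod f f ` E" using uv by force
      qed
    qed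
  qed
  finally show ?thesis by (simp add: card_parcs_turan_graph)
qed

text \<open>Equality excludes a \<open>k\<close>-clique by strictness; then all orientations count,
  the number of edges is the Turan number, and the equality case of \<open>turan\<close> yields the
  isomorphism.\<close>

lemma S_graph_eq_turan_iff:
  assumes G: "pair_graph G" "card (pverts G) = n" and k: "4 \<le> k" and nk: "\<not> (n = 4 \<and> k = 4)"
  shows "S_graph k G = 2 ^ turan_number (k - 1) n \<longleftrightarrow>
    digraph_iso (with_proj G) (with_proj (turan_graph (k - 1) n))"
proof -
  note V = pair_graph_arcs_simple[OF G(1)]
  have S: "S_graph k G = card (free_orients k (parcs G))" using S_graph_eq[OF G(1)] k by simp
  have iso: "digraph_iso (with_proj G) (with_proj (turan_graph (k - 1) n)) \<longleftrightarrow>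
    (\<exists>f. bij_betw f (pverts G) {..<n} \<and> (\<forall>u\<in>pverts G. \<forall>v\<in>pverts G.
      (u, v) \<in> parcs G \<longleftrightarrow> f u mod (k - 1) \<noteq> f v mod (k - 1)))"
    unfolding digraph_iso_pair_iff[OF G(1) pair_graph_turan_graph]
    by (rule ex_cong1, rule conj_cong[OF _ ball_cong[OF refl ball_cong[OF refl]]])
      (auto simp: turan_graph_def bij_betw_def)
  show ?thesis
  proof
    assume eq: "S_graph k G = 2 ^ turan_number (k - 1) n"
    have none: "card W \<noteq> k" if "W \<subseteq> pverts G" "clique_in (parcs G) W" for W
      using card_free_orients_bound[OF k V] that nk eq S G(2) by auto
    note cf = clique_free_free_orients[OF V k none]
    have "(2::nat) ^ (card (parcs G) div 2) = 2 ^ turan_number (k - 1) n" using cf(1) eq S by simp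
    then have "card (parcs G) div 2 = turan_number (k - 1) n" by simp
    then have "card (parcs G) = 2 * turan_number (k - 1) (card (pverts G))"
      using cf(3) G(2) by auto
    moreover have "0 < k - 1" "\<And>W. W \<subseteq> pverts G \<Longrightarrow> clique_in (parcs G) W \<Longrightarrow> card W \<noteq> Suc (k - 1)"
      using k none by auto
    ultimately show "digraph_iso (with_proj G) (with_proj (turan_graph (k - 1) n))"
      unfolding iso using turan(2)[OF V] G(2) by blast
  next
    assume "digraph_iso (with_proj G) (with_proj (turan_graph (k - 1) n))"
    then obtain f where f: "bij_betw f (pverts G) {..<n}" "\<And>u v. u \<in> pverts G \<Longrightarrow> v \<in> pverts G \<Longrightarrow>
      (u, v) \<in> parcs G \<longleftrightarrow> f u mod (k - 1) \<noteq> f v mod (k - 1)"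
      unfolding iso by blast
    then show "S_graph k G = 2 ^ turan_number (k - 1) n"
      using free_orients_turan[OF V k, of f] S G(2) by simp
  qed
qed

text \<open>Any other graph on four vertices is \<open>K\<^sub>4\<close>-free, so it has at most 5
  edges and at most \<open>32\<close> orientations.\<close>

lemma S_graph_4_eq_40_iff:
  assumes G: "pair_graph G" "card (pverts G) = 4"
  shows "S_graph 4 G = 40 \<longleftrightarrow> complete_digraph 4 (with_proj G)"
proof -
  note V = pair_graph_arcs_simple[OF G(1)]
  have S: "S_graph 4 G = card (free_orients 4 (parcs G))" using S_graph_eq[OF G(1)] by simp
  have compl: "complete_digraph 4 (with_proj G) \<longleftrightarrow> parcs G = complete_arcs (pverts G)"
    using V(1) G(2) unfolding complete_digraph_pair_def by auto
  show ?thesis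
  proof
    assume "S_graph 4 G = 40"
    show "complete_digraph 4 (with_proj G)"
    proof (rule ccontr)
      assume not: "\<not> ?thesis"
      have none: "card W \<noteq> 4" if "W \<subseteq> pverts G" "clique_in (parcs G) W" for W
      proof
        assume "card W = 4"
        then have "W = pverts G" using that V(1) G(2) by (metis card_subset_eq)
        then have "parcs G = complete_arcs (pverts G)"
          using that V(2,4) unfolding clique_in_def irrefl_def by auto
        then show False using not compl by blast
      qed
      note cf = clique_free_free_orients[OF V order_refl none]
      have "card (parcs G) div 2 \<le> 5" using cf(2) G(2) by (simp add: turan_number_3)
      then have "(2::nat) ^ (card (parcs G) div 2) \<le> 2 ^ 5" by (intro power_increasing) auto
      then show False using cf(1) S \<open>S_graph 4 G = 40\<close> by simp
    qed
  next
    assume "complete_digraph 4 (with_proj G)"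
    then show "S_graph 4 G = 40"
      using S compl four_free_complete_4[OF G(2)] by simp
  qed
qed

lemma S_max_eq:
  assumes "4 \<le> k"
  shows "S_max k n = free_bound k n"
  unfolding S_max_def
proof (rule Max_eqI)
  show "finite {S_graph k G |G :: nat pair_pre_digraph. pair_graph G \<and> card (pverts G) = n}"
    by (rule S_max_attained)
next
  fix s assume "s \<in> {S_graph k G |G :: nat pair_pre_digraph. pair_graph G \<and> card (pverts G) = n}"
  then obtain G :: "nat pair_pre_digraph"
    where G: "s = S_graph k G" "pair_graph G" "card (pverts G) = n" by blast
  then show "s \<le> free_bound k n"
    using card_free_orients_bound[OF assms pair_graph_arcs_simple[OF G(2)]] S_graph_eq[OF G(2), of k]
      assms by simp
next
  have card: "card (pverts (turan_graph r n)) = n" for r by (simp add: turan_graph_def)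
  have "\<exists>G :: nat pair_pre_digraph. pair_graph G \<and> card (pverts G) = n \<and> S_graph k G = free_bound k n"
  proof (cases "n = 4 \<and> k = 4")
    case True
    \<comment> \<open>With four singleton parts the Turan graph is \<open>K\<^sub>4\<close>.\<close>
    have "complete_digraph 4 (with_proj (turan_graph 4 4))"
      by (auto simp: complete_digraph_pair_def turan_graph_def)
    then show ?thesis
      using True S_graph_4_eq_40_iff[OF pair_graph_turan_graph, of 4 4] card[of 4]
        pair_graph_turan_graph[of 4 4]
      by (intro exI[of _ "turan_graph 4 4"]) (simp add: free_bound_def)
  next
    case False
    have "digraph_iso (with_proj (turan_graph (k - 1) n)) (with_proj (turan_graph (k - 1) n))"
      unfolding digraph_iso_pair_iff[OF pair_graph_turan_graph pair_graph_turan_graph]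
      by (intro exI[of _ id]) auto
    moreover have "free_bound k n = 2 ^ turan_number (k - 1) n"
      unfolding free_bound_def using False by (rule if_not_P)
    ultimately show ?thesis
      using S_graph_eq_turan_iff[OF pair_graph_turan_graph card assms False] card
        pair_graph_turan_graph
      by (intro exI[of _ "turan_graph (k - 1) n"]) simp
  qed
  then show "free_bound k n \<in> {S_graph k G |G :: nat pair_pre_digraph.
      pair_graph G \<and> card (pverts G) = n}"
    by (metis (mono_tags, lifting) mem_Collect_eq)
qed

theorem theorem3p7:
  fixes n k :: nat
  assumes "n \<ge> k" and "k \<ge> 4"
  shows "S_max k n = (if n = 4 \<and> k = 4 then 40 else 2 ^ turan_number (k - 1) n) \<and>
    (\<forall>G :: 'a pair_pre_digraph. pair_graph G \<and> card (pverts G) = 4 \<longrightarrow>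
        (S_graph 4 G = S_max 4 4 \<longleftrightarrow> complete_digraph 4 (with_proj G))) \<and>
    (n \<ge> 5 \<or> k \<ge> 5 \<longrightarrow>
      (\<forall>G :: 'a pair_pre_digraph. pair_graph G \<and> card (pverts G) = n \<longrightarrow>
        (S_graph k G = S_max k n \<longleftrightarrow>
           digraph_iso (with_proj G) (with_proj (turan_graph (k - 1) n)))))"
proof (intro conjI impI allI)
  show "S_max k n = (if n = 4 \<and> k = 4 then 40 else 2 ^ turan_number (k - 1) n)"
    using S_max_eq[OF assms(2)] by (simp only: free_bound_def)
next
  fix G :: "'a pair_pre_digraph" assume "pair_graph G \<and> card (pverts G) = 4"
  then show "S_graph 4 G = S_max 4 4 \<longleftrightarrow> complete_digraph 4 (with_proj G)"
    using S_graph_4_eq_40_iff[of G] S_max_eq[of 4 4] by (simp add: free_bound_def)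
next
  fix G :: "'a pair_pre_digraph"
  assume nk: "n \<ge> 5 \<or> k \<ge> 5" and G: "pair_graph G \<and> card (pverts G) = n"
  then have ne: "\<not> (n = 4 \<and> k = 4)" by auto
  then have "S_max k n = 2 ^ turan_number (k - 1) n"
    unfolding S_max_eq[OF assms(2)] free_bound_def by (rule if_not_P)
  then show "S_graph k G = S_max k n \<longleftrightarrow>
      digraph_iso (with_proj G) (with_proj (turan_graph (k - 1) n))"
    using S_graph_eq_turan_iff[of G n k] G assms(2) ne by simp
qed

end
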